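(* Fix $k\in\mathbb{N}_0$ and $A\ge 0$. (Charlier) Let $\mu>0$, let $\{C_n^{\mu,A}\}_{n\ge0}$ be the mass-modified monic Charlier polynomials, let $\theta_n(z)=(-1)^n/\Gamma(n-z)$ and $\varphi_C(z)=e^{\mu}/\Gamma(-z)$. Then, locally uniformly for $z\in\mathbb{C}$, $$\lim_{n\to\infty}\frac{\theta_n(z)}{[n]_k}\,\nabla^kC_n^{\mu,A}(z)=(-1)^k\varphi_C(z-k)=(-1)^k\frac{e^{\mu}}{\Gamma(k-z)}.$$ (Meixner) Let $\gamma>0$, $0<\mu<1$, let $\{M_n^{\gamma,\mu,A}\}_{n\ge0}$ be the mass-modified monic Meixner polynomials, let $\theta_n(z)=(\mu-1)^n/\Gamma(n-z)$ and $\varphi_M(z)=\dfrac{1}{(1-\mu)^{\gamma+z}\Gamma(-z)}$. Then, locally uniformly for $z\in\mathbb{C}$, $$\lim_{n\to\infty}\frac{\theta_n(z)}{[n]_k}\,\nabla^kM_n^{\gamma,\mu,A}(z)=(-1)^k\varphi_M(z-k)=(-1)^k\frac{1}{(1-\mu)^{\gamma+z-k}\,\Gamma(k-z)}.$$ Thus, for each fixed $A\ge0$ and $k\in\mathbb{N}_0$, these limits are the same as those of the classical polynomials (the case $A=0$).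
   Context: $\mathbb{N}_0=\{0,1,2,\dots\}$. Difference operator: $\nabla f(x)=f(x)-f(x-1)$, $\nabla^k=\nabla\circ\nabla^{k-1}$, $\nabla^0=\mathrm{Id}$. Falling factorial: $[x]_0=1$, $[x]_k=\prod_{j=0}^{k-1}(x-j)$ for $k\ge1$ (so $[n]_k\neq0$ for integers $n\ge k$). Classical families: the monic polynomials $P_n$ are determined by $P_{-1}=0$, $P_0=1$ and $xP_n(x)=P_{n+1}(x)+\alpha_nP_n(x)+\beta_nP_{n-1}(x)$ for $n\ge 0$. Their classical inner product $\langle\cdot,\cdot\rangle$ on the space of real polynomials satisfies $\langle P_m,P_n\rangle=d_n^2\delta_{mn}$. The data are: - monic Charlier $C_n^{\mu}$, $\mu>0$: $\alpha_n=n+\mu$, $\beta_n=n\mu$, $d_n^2=n!\,\mu^n$; equivalently $\langle p,q\rangle=\sum_{x=0}^{\infty}p(x)q(x)\,e^{-\mu}\mu^x/x!$; - monic Meixner $M_n^{\gamma,\mu}$, $\gamma>0$, $0<\mu<1$: $\alpha_n=\dfrac{n(1+\mu)+\mu\gamma}{1-\mu}$, $\beta_n=\dfrac{n\mu(n-1+\gamma)}{(\mu-1)^2}$, $d_n^2=\dfrac{n!\,(\gamma)_n\,\mu^n}{(1-\mu)^{\gamma+2n}}$; equivalently $\langle p,q\rangle=\sum_{x=0}^{\infty}p(x)q(x)\,(\gamma)_x\mu^x/x!$, where $(\gamma)_n=\Gamma(\gamma+n)/\Gamma(\gamma)$. Mass-modified families: for $A\ge0$, $\{C_n^{\mu,A}\}$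 (respectively $\{M_n^{\gamma,\mu,A}\}$) is the sequence of monic polynomials ($\deg=n$) orthogonal with respect to $\langle p,q\rangle_A=\langle p,q\rangle+A\,p(0)q(0)$, with $\langle\cdot,\cdot\rangle$ the Charlier (respectively Meixner) inner product above. $1/\Gamma$ denotes the entire reciprocal Gamma function (equal to $0$ at nonpositive integers). The power $(1-\mu)^{w}$ means $\exp(w\log(1-\mu))$ with the real logarithm. "Locally uniformly" means uniformly on compact subsets of $\mathbb{C}$. *)

theory Defs
  imports "HOL-Analysis.Analysis" "HOL-Computational_Algebra.Computational_Algebra"
begin

definition nabla :: "(complex \<Rightarrow> complex) \<Rightarrow> complex \<Rightarrow> complex" where
  "nabla f x = f x - f (x - 1)"

definition falling_factorial :: "complex \<Rightarrow> nat \<Rightarrow> complex" where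
  "falling_factorial x k = (\<Prod>j<k. x - of_nat j)"

definition cpoly :: "real poly \<Rightarrow> complex \<Rightarrow> complex" where
  "cpoly p z = poly (map_poly complex_of_real p) z"

text \<open>The recurrence \<open>x P\<^sub>n = P\<^sub>n\<^sub>+\<^sub>1 + \<alpha>\<^sub>n P\<^sub>n + \<beta>\<^sub>n P\<^sub>n\<^sub>-\<^sub>1\<close>, solved for
  \<open>P\<^sub>n\<^sub>+\<^sub>1\<close>. Since \<open>P\<^sub>-\<^sub>1 = 0\<close>, the value \<open>\<beta> 0\<close> is never used.\<close>

fun monic_recurrence :: "(nat \<Rightarrow> real) \<Rightarrow> (nat \<Rightarrow> real) \<Rightarrow> nat \<Rightarrow> real poly" where
  "monic_recurrence \<alpha> \<beta> 0 = 1"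
| "monic_recurrence \<alpha> \<beta> (Suc 0) = [:- \<alpha> 0, 1:]"
| "monic_recurrence \<alpha> \<beta> (Suc (Suc n)) =
     [:- \<alpha> (Suc n), 1:] * monic_recurrence \<alpha> \<beta> (Suc n)
       - smult (\<beta> (Suc n)) (monic_recurrence \<alpha> \<beta> n)"

definition charlier :: "real \<Rightarrow> nat \<Rightarrow> real poly" where
  "charlier \<mu> = monic_recurrence (\<lambda>n. real n + \<mu>) (\<lambda>n. real n * \<mu>)"

definition meixner :: "real \<Rightarrow> real \<Rightarrow> nat \<Rightarrow> real poly" where
  "meixner \<gamma> \<mu> = monic_recurrence
     (\<lambda>n. (real n * (1 + \<mu>) + \<mu> * \<gamma>) / (1 - \<mu>))
     (\<lambda>n. real n * \<mu> * (real n - 1 + \<gamma>) / (\<mu> - 1)\<^sup>2)"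

text \<open>For the admissible parameters both series converge absolutely for all polynomials.
  The Meixner weight is not normalised to total mass one.\<close>

definition charlier_inner :: "real \<Rightarrow> real poly \<Rightarrow> real poly \<Rightarrow> real" where
  "charlier_inner \<mu> p q =
     (\<Sum>x. poly p (real x) * poly q (real x) * (exp (- \<mu>) * \<mu> ^ x / fact x))"

definition meixner_inner :: "real \<Rightarrow> real \<Rightarrow> real poly \<Rightarrow> real poly \<Rightarrow> real" where
  "meixner_inner \<gamma> \<mu> p q =
     (\<Sum>x. poly p (real x) * poly q (real x) * (pochhammer \<gamma> x * \<mu> ^ x / fact x))"

definition mass_inner ::
    "(real poly \<Rightarrow> real poly \<Rightarrow> real) \<Rightarrow> real \<Rightarrow> real poly \<Rightarrow> real poly \<Rightarrow> real" where
  "mass_inner ip A p q = ip p q + A * poly p 0 * poly q 0"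

definition monic_orthogonal ::
    "(real poly \<Rightarrow> real poly \<Rightarrow> real) \<Rightarrow> (nat \<Rightarrow> real poly) \<Rightarrow> bool" where
  "monic_orthogonal ip P \<longleftrightarrow>
     (\<forall>n. degree (P n) = n \<and> lead_coeff (P n) = 1) \<and>
     (\<forall>m n. m \<noteq> n \<longrightarrow> ip (P m) (P n) = 0)"

definition charlier_theta :: "nat \<Rightarrow> complex \<Rightarrow> complex" where
  "charlier_theta n z = (- 1) ^ n * rGamma (of_nat n - z)"

definition charlier_phi :: "real \<Rightarrow> complex \<Rightarrow> complex" where
  "charlier_phi \<mu> z = of_real (exp \<mu>) * rGamma (- z)"

definition meixner_theta :: "real \<Rightarrow> nat \<Rightarrow> complex \<Rightarrow> complex" where
  "meixner_theta \<mu> n z = of_real (\<mu> - 1) ^ n * rGamma (of_nat n - z)"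

text \<open>Power with complex exponent and real base \<open>b > 0\<close>, through the real logarithm.\<close>

definition cpow :: "real \<Rightarrow> complex \<Rightarrow> complex" where
  "cpow b w = exp (w * of_real (ln b))"

definition meixner_phi :: "real \<Rightarrow> real \<Rightarrow> complex \<Rightarrow> complex" where
  "meixner_phi \<gamma> \<mu> z = 1 / cpow (1 - \<mu>) (of_real \<gamma> + z) * rGamma (- z)"

definition locally_uniform_limit ::
    "(nat \<Rightarrow> complex \<Rightarrow> complex) \<Rightarrow> (complex \<Rightarrow> complex) \<Rightarrow> bool" where
  "locally_uniform_limit F f \<longleftrightarrow> (\<forall>K. compact K \<longrightarrow> uniform_limit K F f sequentially)"

end

theory Submission
  imports Defs "HOL-Real_Asymp.Real_Asymp"
begin

text \<open>
Both families are one family.  For \<open>a > 0\<close> and \<open>0 \<le> b < 1\<close> let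
\<open>w a b x = a (a + b) \<dots> (a + (x - 1) b) / x!\<close>; then \<open>b = 0\<close> gives the Charlier weight (up to the
factor \<open>exp (- a)\<close>) and \<open>(a, b) = (\<mu> \<gamma>, \<mu>)\<close> gives the Meixner weight.  The monic orthogonal
polynomials \<open>P n\<close> (with parameters \<open>a\<close>, \<open>b\<close>) have the generating function
\<open>(1 + s)\<^sup>x (1 + b s) powr (- x - a / b)\<close> (the second factor is \<open>exp (- a s)\<close> if \<open>b = 0\<close>), whose coefficient of \<open>s\<^sup>n\<close> is \<open>(1 - b)\<^sup>n P n (x) / n!\<close>.
As a product of two series of the same kind it yields at once the three relations on which
everything rests: the three-term recurrence, the lowering relation
\<open>\<nabla> (P n) (x) = n P (n - 1) (x - 1)\<close>, with \<open>P (n - 1)\<close> for the parameter \<open>a + b\<close>, and the raising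
relation (\<open>cm_value_recurrence\<close>, \<open>cm_value_difference\<close>, \<open>cm_value_raising\<close>).

\<^emph>\<open>The classical limit.\<close>  The lowering relation turns \<open>\<nabla>\<^sup>k (P n)\<close> into \<open>[n]\<^sub>k\<close> times
\<open>P (n - k)\<close> at \<open>z - k\<close> with parameter \<open>a + k b\<close>.  The quantity \<open>a + b z\<close> is unchanged when
\<open>(a, z)\<close> becomes \<open>(a + k b, z - k)\<close>, so the case \<open>k = 0\<close> suffices.
There the generating function writes \<open>\<theta> n (z) P n (z)\<close> as a sum over \<open>i \<le> n\<close> of a ratio of Gamma
values times the product \<open>(a + b z) (a + b z + b) \<dots> (a + b z + (i - 1) b) / i!\<close>.
For fixed \<open>i\<close> the ratio tends to \<open>1 / \<Gamma>(- z)\<close>.  On a compact set it is bounded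
by \<open>C q\<^sup>i\<close> for every \<open>q > 1\<close>, while the products decay like \<open>\<rho>\<^sup>i\<close> for every \<open>\<rho> > b\<close>.
A uniform version of Tannery's theorem gives the limit
\<open>1 / \<Gamma>(- z)\<close> times the full series, that is, \<open>exp \<mu>\<close> or \<open>(1 - \<mu>) powr (- \<gamma> - z)\<close>.

\<^emph>\<open>The mass at the origin.\<close>  Multiplication by \<open>x\<close> turns the weight with parameter \<open>a\<close> into the
shifted weight with parameter \<open>a + b\<close>.  Hence \<open>\<nabla> (P n)\<close> is orthogonal to every \<open>x r (x)\<close> with
\<open>degree r < n - 1\<close>, so pairing with it evaluates polynomials of degree below \<open>n\<close> at \<open>0\<close>, up to a constant
(\<open>cm_kernel_reproducing\<close>).  The modified polynomial therefore is \<open>P n - c \<nabla> (P n)\<close> for a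
number \<open>c\<close> that depends on \<open>n\<close>, and \<open>c\<close> is bounded by a constant multiple of the weight at \<open>n\<close>
(\<open>mass_modified_eq\<close>).  By the classical limit one further backward difference of \<open>P n\<close> costs only a factor
of order \<open>n\<close>, and since \<open>n\<close> times the weight at \<open>n\<close> tends to \<open>0\<close>, the correction disappears in the limit.
\<close>

section \<open>A generating function common to both families\<close>

text \<open>
This is the rising factorial with step \<open>c\<close>; steps \<open>1\<close>, \<open>-1\<close>, \<open>0\<close> give Pochhammer symbols, falling
factorials and powers.  The parameter \<open>c = 0\<close> is what lets the Charlier case appear as a value
of the parameters instead of as a limit.
\<close>
definition step_pochhammer :: "'a::comm_ring_1 \<Rightarrow> 'a \<Rightarrow> nat \<Rightarrow> 'a" where
  "step_pochhammer c v n = (\<Prod>j<n. v + of_nat j * c)"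

lemma step_pochhammer_0 [simp]: "step_pochhammer c v 0 = 1"
  by (simp add: step_pochhammer_def)

lemma step_pochhammer_Suc: "step_pochhammer c v (Suc n) = step_pochhammer c v n * (v + of_nat n * c)"
  by (simp add: step_pochhammer_def)

lemma step_pochhammer_rec: "step_pochhammer c v (Suc n) = v * step_pochhammer c (v + c) n"
  unfolding step_pochhammer_def by (subst prod.lessThan_Suc_shift) (simp add: algebra_simps)

lemma step_pochhammer_pos:
  fixes c v :: real
  assumes "v > 0" "c \<ge> 0"
  shows "step_pochhammer c v n > 0"
  using assms unfolding step_pochhammer_def by (intro prod_pos) (auto intro: add_pos_nonneg)

lemma step_pochhammer_1: "step_pochhammer 1 v n = pochhammer v n"
  by (simp add: step_pochhammer_def pochhammer_prod lessThan_atLeast0)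

lemma step_pochhammer_scale: "step_pochhammer (r * c) (r * v) n = r ^ n * step_pochhammer c v n"
  by (induction n) (simp_all add: step_pochhammer_Suc algebra_simps)

text \<open>
As a function this is \<open>(1 - c s) powr (- v / c)\<close>, or \<open>exp (v s)\<close> if \<open>c = 0\<close>.
\<close>
definition step_series :: "'a::field_char_0 \<Rightarrow> 'a \<Rightarrow> 'a fps" where
  "step_series c v = Abs_fps (\<lambda>i. step_pochhammer c v i / fact i)"

lemma step_series_nth: "step_series c v $ i = step_pochhammer c v i / fact i"
  by (simp add: step_series_def)

lemma fps_deriv_step_series: "fps_deriv (step_series c v) = fps_const v * step_series c (v + c)"
proof (rule fps_ext)
  fix n
  show "fps_deriv (step_series c v) $ n = (fps_const v * step_series c (v + c)) $ n"
    by (simp add: step_series_nth step_pochhammer_rec del: of_nat_Suc)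
qed

lemma step_series_shift: "(1 - fps_const c * fps_X) * step_series c (v + c) = step_series c v"
proof (rule fps_ext)
  fix n
  show "((1 - fps_const c * fps_X) * step_series c (v + c)) $ n = step_series c v $ n"
  proof (cases n)
    case (Suc m)
    have [simp]: "1 + (of_nat m :: 'a) \<noteq> 0" "(of_nat m :: 'a) + 1 \<noteq> 0"
      by (metis of_nat_Suc of_nat_neq_0) (metis of_nat_Suc of_nat_neq_0 add.commute)
    have "((1 - fps_const c * fps_X) * step_series c (v + c)) $ n
            = step_series c (v + c) $ Suc m - c * step_series c (v + c) $ m"
      using Suc by (simp add: left_diff_distrib mult.assoc)
    also have "\<dots> = step_series c v $ Suc m"
      unfolding step_series_nth step_pochhammer_rec[of c v] step_pochhammer_Suc[of c "v + c"]
      by (simp add: divide_simps) (simp add: algebra_simps)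
    finally show ?thesis using Suc by simp
  qed (simp add: step_series_nth)
qed

text \<open>
The generating function \<open>(1 + s)\<^sup>x (1 + b s) powr (- x - a / b)\<close>.  The second factor depends on
\<open>a\<close> and \<open>x\<close> only through \<open>a + b x\<close>, so that the shifts \<open>x \<mapsto> x - 1\<close> and \<open>a \<mapsto> a + b\<close> cancel in it.
\<close>
definition cm_series :: "'a::field_char_0 \<Rightarrow> 'a \<Rightarrow> 'a \<Rightarrow> 'a fps" where
  "cm_series a b x = step_series (-1) x * step_series (- b) (- (a + b * x))"

lemma cm_series_0 [simp]: "cm_series a b x $ 0 = 1"
  by (simp add: cm_series_def step_series_nth fps_mult_nth)

text \<open>
Raising \<open>x\<close> by one multiplies the first factor by \<open>1 + s\<close>, and raising \<open>a\<close> by \<open>b\<close>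
divides the second by \<open>1 + b s\<close>; the difference of the two linear polynomials is \<open>(1 - b) s\<close>.
\<close>
lemma cm_series_difference:
  "cm_series a b (x + 1) - cm_series a b x = fps_const (1 - b) * (fps_X * cm_series (a + b) b x)"
proof -
  have 1: "step_series (-1) (x + 1) = (1 + fps_X) * step_series (-1) x"
    using step_series_shift[of "-1" "x + 1"] by (simp flip: fps_const_neg)
  have 2: "step_series (-b) (-(a + b * x)) =
      (1 + fps_const b * fps_X) * step_series (-b) (-(a + b * (x + 1)))"
    using step_series_shift[of "-b" "-(a + b * x)"]
    by (simp add: algebra_simps flip: fps_const_neg)
  have 3: "a + b + b * x = a + b * (x + 1)" by (simp add: algebra_simps)
  show ?thesis unfolding cm_series_def 1 2 3
    by (simp add: algebra_simps flip: fps_const_sub)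
qed

text \<open>
The product rule: differentiating either factor shifts its own parameter and leaves the other
factor alone.
\<close>
lemma fps_deriv_cm_series:
  "fps_deriv (cm_series a b x) =
     fps_const x * cm_series (a + b) b (x - 1) - fps_const (a + b * x) * cm_series (a + b) b x"
proof -
  have 1: "- (a + b + b * (x - 1)) = - (a + b * x)" "- (a + b + b * x) = - (a + b * x) + - b"
    by (simp_all add: algebra_simps)
  have 2: "fps_const (- (a + b * x)) = - fps_const (a + b * x)" by simp
  have 3: "step_series (- 1) (x + - 1) = step_series (- 1) (x - 1)" by simp
  define U where "U = fps_const (a + b * x)"
  show ?thesis
    unfolding cm_series_def fps_deriv_mult fps_deriv_step_series 1 2 3 U_def[symmetric]
    by (simp add: algebra_simps)
qed

text \<open>
Multiplying the derivative by both linear factors undoes the parameter shifts.  Comparing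
coefficients in this equation is the three-term recurrence.
\<close>
lemma cm_series_ode:
  "(1 + fps_X) * (1 + fps_const b * fps_X) * fps_deriv (cm_series a b x) =
     (fps_const ((1 - b) * x - a) - fps_const a * fps_X) * cm_series a b x"
proof -
  have 1: "(1 + fps_X) * step_series (-1) (x + - 1) = step_series (-1) x"
    using step_series_shift[of "-1" x] by (simp flip: fps_const_neg)
  have 2: "(1 + fps_const b * fps_X) * step_series (-b) (-(a + b * x) + - b) = step_series (-b) (-(a + b * x))"
    using step_series_shift[of "-b" "-(a + b * x)"]
    by (simp add: algebra_simps flip: fps_const_neg)
  let ?A = "step_series (-1) x" and ?B = "step_series (- b) (- (a + b * x))"
  have "(1 + fps_X) * (1 + fps_const b * fps_X) * fps_deriv (cm_series a b x)
      = fps_const x * (1 + fps_const b * fps_X) * ((1 + fps_X) * step_series (-1) (x + - 1)) * ?B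
        + fps_const (-(a + b * x)) * (1 + fps_X) * ?A *
          ((1 + fps_const b * fps_X) * step_series (-b) (-(a + b * x) + - b))"
    unfolding cm_series_def fps_deriv_mult fps_deriv_step_series by (simp only: algebra_simps)
  also have "\<dots> = (fps_const x * (1 + fps_const b * fps_X) - fps_const (a + b * x) * (1 + fps_X)) * (?A * ?B)"
  proof -
    define U where "U = fps_const (a + b * x)"
    show ?thesis unfolding 1 2 fps_const_neg[symmetric] U_def[symmetric] by (simp add: algebra_simps)
  qed
  also have "fps_const x * (1 + fps_const b * fps_X) - fps_const (a + b * x) * (1 + fps_X)
      = fps_const ((1 - b) * x - a) - fps_const a * fps_X"
    by (simp add: algebra_simps flip: fps_const_add fps_const_sub fps_const_mult)
  finally show ?thesis by (simp only: cm_series_def)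
qed

definition cm_value :: "'a::field_char_0 \<Rightarrow> 'a \<Rightarrow> nat \<Rightarrow> 'a \<Rightarrow> 'a" where
  "cm_value a b n x = fact n / (1 - b) ^ n * cm_series a b x $ n"

lemma cm_value_difference:
  assumes "b \<noteq> 1"
  shows "cm_value a b (Suc n) (x + 1) - cm_value a b (Suc n) x = of_nat (Suc n) * cm_value (a + b) b n x"
proof -
  have "cm_series a b (x + 1) $ Suc n - cm_series a b x $ Suc n = (1 - b) * cm_series (a + b) b x $ n"
    using arg_cong[OF cm_series_difference[of a b x], of "\<lambda>f. f $ Suc n"] by simp
  moreover have "cm_value a b (Suc n) (x + 1) - cm_value a b (Suc n) x =
      fact (Suc n) / (1 - b) ^ Suc n * (cm_series a b (x + 1) $ Suc n - cm_series a b x $ Suc n)"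
    by (simp only: cm_value_def right_diff_distrib)
  ultimately show ?thesis using assms by (simp add: cm_value_def)
qed

lemma cm_value_raising:
  assumes "b \<noteq> 1"
  shows "(1 - b) * cm_value a b (Suc n) x =
    x * cm_value (a + b) b n (x - 1) - (a + b * x) * cm_value (a + b) b n x"
proof -
  have "of_nat (Suc n) * cm_series a b x $ Suc n =
     x * cm_series (a + b) b (x - 1) $ n - (a + b * x) * cm_series (a + b) b x $ n"
    using arg_cong[OF fps_deriv_cm_series[of a b x], of "\<lambda>f. f $ n"] by simp
  moreover have "(1 - b) * cm_value a b (Suc n) x = fact n / (1 - b) ^ n * (of_nat (Suc n) * cm_series a b x $ Suc n)"
    using assms by (simp add: cm_value_def)
  ultimately have "(1 - b) * cm_value a b (Suc n) x = fact n / (1 - b) ^ n *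
      (x * cm_series (a + b) b (x - 1) $ n - (a + b * x) * cm_series (a + b) b x $ n)"
    by (simp only:)
  thus ?thesis unfolding cm_value_def by (simp only: right_diff_distrib mult_ac)
qed

lemma cm_value_recurrence:
  assumes "b \<noteq> 1"
  shows "cm_value a b (Suc (Suc n)) x =
     (x - (of_nat (Suc n) * (1 + b) + a) / (1 - b)) * cm_value a b (Suc n) x
     - of_nat (Suc n) * (a + b * of_nat n) / (1 - b)\<^sup>2 * cm_value a b n x"
proof -
  let ?F = "cm_series a b x" and ?N = "of_nat n :: 'a"
  have eq: "fps_deriv ?F + fps_const (1 + b) * (fps_X * fps_deriv ?F)
      + fps_const b * (fps_X * (fps_X * fps_deriv ?F)) =
     fps_const ((1 - b) * x - a) * ?F - fps_const a * (fps_X * ?F)"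
    using cm_series_ode[of b a x]
    by (simp add: algebra_simps flip: fps_const_add)
  have "(?N + 2) * ?F $ Suc (Suc n) + (1 + b) * (?N + 1) * ?F $ Suc n + b * ?N * ?F $ n
     = ((1 - b) * x - a) * ?F $ Suc n - a * ?F $ n"
    using arg_cong[OF eq, of "\<lambda>f. f $ Suc n"] by (cases n) (simp_all add: algebra_simps)
  hence *: "(?N + 2) * ?F $ Suc (Suc n) =
      ((1 - b) * x - a - (1 + b) * (?N + 1)) * ?F $ Suc n - (a + b * ?N) * ?F $ n"
    by (simp add: algebra_simps)
  have "cm_value a b (Suc (Suc n)) x =
      fact (Suc n) / (1 - b) ^ Suc (Suc n) * ((?N + 2) * ?F $ Suc (Suc n))"
    by (simp add: cm_value_def algebra_simps)
  also have "\<dots> = ((1 - b) * x - a - (1 + b) * (?N + 1)) / (1 - b) * cm_value a b (Suc n) x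
      - (?N + 1) * (a + b * ?N) / (1 - b)\<^sup>2 * cm_value a b n x"
  proof -
    define c K L where "c = 1 - b" and "K = (1 - b) * x - a - (1 + b) * (?N + 1)" and "L = a + b * ?N"
    have "c \<noteq> 0" using assms by (simp add: c_def)
    thus ?thesis
      unfolding * cm_value_def c_def[symmetric] K_def[symmetric] L_def[symmetric]
      by (simp add: field_simps power2_eq_square)
  qed
  also have "((1 - b) * x - a - (1 + b) * (?N + 1)) / (1 - b) = x - (of_nat (Suc n) * (1 + b) + a) / (1 - b)"
    using assms by (simp add: field_simps)
  finally show ?thesis by (simp add: algebra_simps)
qed

lemma cm_value_0 [simp]: "cm_value a b 0 x = 1"
  by (simp add: cm_value_def)

lemma cm_value_1:
  assumes "b \<noteq> 1"
  shows "cm_value a b (Suc 0) x = x - a / (1 - b)"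
  using cm_value_raising[OF assms, of a 0 x] assms by (simp add: field_simps)

text \<open>
Stated for an abstract sequence so that it serves both the values of the real polynomials on
the line, which enter the inner products, and their complex values, which enter the limit.
\<close>
lemma recurrence_eq_cm_value:
  assumes "b \<noteq> 1" "y 0 = 1" "y (Suc 0) = x - a / (1 - b)"
    and "\<And>n. y (Suc (Suc n)) = (x - (of_nat (Suc n) * (1 + b) + a) / (1 - b)) * y (Suc n)
     - of_nat (Suc n) * (a + b * of_nat n) / (1 - b)\<^sup>2 * y n"
  shows "y n = cm_value a b n x"
proof (induction n rule: induct_nat_012)
  case (ge2 n)
  then show ?case by (simp only: assms(4) cm_value_recurrence[OF assms(1)])
qed (simp_all add: assms cm_value_1)

section \<open>The monic polynomials\<close>

text \<open>
The coefficients specialise to those of the Charlier recurrence at \<open>b = 0\<close>, \<open>a = \<mu>\<close> and to those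
of the Meixner recurrence at \<open>b = \<mu>\<close>, \<open>a = \<mu> \<gamma>\<close>.
\<close>
definition cm_poly :: "real \<Rightarrow> real \<Rightarrow> nat \<Rightarrow> real poly" where
  "cm_poly a b = monic_recurrence (\<lambda>n. (real n * (1 + b) + a) / (1 - b))
     (\<lambda>n. real n * (a + b * (real n - 1)) / (1 - b)\<^sup>2)"

lemma charlier_eq_cm_poly: "charlier \<mu> = cm_poly \<mu> 0"
  by (simp add: charlier_def cm_poly_def mult.commute)

lemma meixner_eq_cm_poly: "meixner \<gamma> \<mu> = cm_poly (\<mu> * \<gamma>) \<mu>"
  by (simp add: meixner_def cm_poly_def algebra_simps power2_commute)

lemma poly_cm_poly:
  assumes "b \<noteq> 1"
  shows "poly (cm_poly a b n) x = cm_value a b n x"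
  by (rule recurrence_eq_cm_value[OF assms]) (simp_all add: cm_poly_def algebra_simps)

lemma cpoly_pCons: "cpoly (pCons c p) z = of_real c + z * cpoly p z"
  by (simp add: cpoly_def map_poly_pCons)

lemma cpoly_const: "cpoly 1 z = 1" "cpoly 0 z = 0"
  by (simp_all add: cpoly_def)

lemma cpoly_add: "cpoly (p + q) z = cpoly p z + cpoly q z"
proof -
  have "map_poly complex_of_real (p + q) = map_poly of_real p + map_poly of_real q"
    by (rule poly_eqI) (simp add: coeff_map_poly)
  thus ?thesis by (simp add: cpoly_def)
qed

lemma cpoly_smult: "cpoly (smult c p) z = of_real c * cpoly p z"
  by (simp add: cpoly_def map_poly_smult)

lemma cpoly_diff: "cpoly (p - q) z = cpoly p z - cpoly q z"
  using cpoly_add[of p "smult (-1) q" z] cpoly_smult[of "-1" q z] by simp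

lemma cpoly_mult: "cpoly (p * q) z = cpoly p z * cpoly q z"
  by (induction p) (simp_all add: cpoly_const cpoly_pCons cpoly_add cpoly_smult algebra_simps)

lemma cpoly_cm_poly:
  assumes "b \<noteq> 1"
  shows "cpoly (cm_poly a b n) z = cm_value (of_real a) (of_real b) n z"
  by (rule recurrence_eq_cm_value)
     (use assms in \<open>simp_all add: cm_poly_def cpoly_const cpoly_diff cpoly_mult cpoly_pCons cpoly_smult left_diff_distrib\<close>)

lemma degree_monic_recurrence:
  "degree (monic_recurrence \<alpha> \<beta> n) = n \<and> lead_coeff (monic_recurrence \<alpha> \<beta> n) = 1"
proof (induction n rule: induct_nat_012)
  case (ge2 n)
  let ?p = "monic_recurrence \<alpha> \<beta> (Suc n)"
  have "?p \<noteq> 0" using ge2(2) by auto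
  have d: "degree ([:- \<alpha> (Suc n), 1:] * ?p) = Suc (Suc n)"
    using ge2(2) \<open>?p \<noteq> 0\<close> by (subst degree_mult_eq) auto
  have "lead_coeff ([:- \<alpha> (Suc n), 1:] * ?p) = 1"
    using ge2(2) by (subst lead_coeff_mult) auto
  moreover have "degree (smult (\<beta> (Suc n)) (monic_recurrence \<alpha> \<beta> n)) < Suc (Suc n)"
    by (rule le_less_trans[OF degree_smult_le]) (use ge2(1) in auto)
  ultimately show ?case using d
    by (metis add_uminus_conv_diff coeff_diff coeff_eq_0 degree_add_eq_left degree_minus diff_zero monic_recurrence.simps(3))
qed auto

lemma coeff_monic_recurrence: "coeff (monic_recurrence \<alpha> \<beta> n) n = 1"
  using degree_monic_recurrence[of \<alpha> \<beta> n] by auto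

lemma degree_cm_poly [simp]: "degree (cm_poly a b n) = n"
  using degree_monic_recurrence by (simp add: cm_poly_def)

lemma lead_coeff_cm_poly [simp]: "coeff (cm_poly a b n) n = 1"
  unfolding cm_poly_def by (rule coeff_monic_recurrence)

section \<open>Geometric decay and the orthogonality functional\<close>

text \<open>
A ratio bound that starts only at some index still gives a geometric bound from the beginning: the
finitely many earlier terms are absorbed into the constant.
\<close>
lemma geometric_bound_of_ratio_bound:
  fixes f :: "nat \<Rightarrow> 'b \<Rightarrow> 'c::real_normed_vector"
  assumes q: "q > 0"
    and bd: "\<And>i. \<exists>B. \<forall>z\<in>K. norm (f i z) \<le> B"
    and ratio: "\<And>i z. i \<ge> N \<Longrightarrow> z \<in> K \<Longrightarrow> norm (f (Suc i) z) \<le> q * norm (f i z)"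
  shows "\<exists>C. \<forall>i. \<forall>z\<in>K. norm (f i z) \<le> C * q ^ i"
proof -
  obtain B where B: "\<And>i z. z \<in> K \<Longrightarrow> norm (f i z) \<le> B i" using bd by metis
  define C where "C = (\<Sum>i\<le>N. \<bar>B i\<bar> / q ^ i)"
  have "norm (f i z) \<le> C * q ^ i" if z: "z \<in> K" for i z
  proof (induction i)
    case (Suc i)
    show ?case
    proof (cases "i \<ge> N")
      case True
      have "norm (f (Suc i) z) \<le> q * (C * q ^ i)"
        using ratio[OF True z] Suc q by (meson mult_left_mono less_imp_le order_trans)
      thus ?thesis by (simp add: mult_ac)
    next
      case False
      have "\<bar>B (Suc i)\<bar> / q ^ Suc i \<le> C"
        unfolding C_def using q False by (intro member_le_sum) auto
      thus ?thesis using B[OF z, of "Suc i"] q by (simp add: field_simps) 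
    qed
  next
    case 0
    have "\<bar>B 0\<bar> / q ^ 0 \<le> C"
      unfolding C_def using q by (intro member_le_sum) auto
    thus ?case using B[OF z, of 0] by simp
  qed
  thus ?thesis by blast
qed

text \<open>
The ratio of consecutive terms is \<open>(v + i c) / (i + 1)\<close>, which tends to \<open>c\<close> uniformly for
bounded \<open>v\<close>.
\<close>
lemma step_pochhammer_geometric_bound:
  fixes c :: "'a::real_normed_field"
  assumes "norm c < \<rho>"
  shows "\<exists>C. \<forall>i. \<forall>v\<in>{v. norm v \<le> R}. norm (step_pochhammer c v i / fact i) \<le> C * \<rho> ^ i"
proof (rule geometric_bound_of_ratio_bound)
  show "\<rho> > 0" using assms norm_ge_zero[of c] by linarith
next
  fix i
  have "norm (step_pochhammer c v i / fact i) \<le> (\<Prod>j<i. R + real j * norm c)" if "norm v \<le> R" for v :: 'a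
  proof -
    have "norm (step_pochhammer c v i / fact i) \<le> norm (step_pochhammer c v i) / 1"
      unfolding norm_divide norm_fact by (intro divide_left_mono) (auto simp: fact_ge_1)
    also have "\<dots> \<le> (\<Prod>j<i. R + real j * norm c)"
      unfolding step_pochhammer_def using that
      by (auto simp: norm_mult simp flip: prod_norm intro!: prod_mono norm_triangle_le add_mono)
    finally show ?thesis .
  qed
  thus "\<exists>B. \<forall>v\<in>{v. norm v \<le> R}. norm (step_pochhammer c v i / fact i) \<le> B" by blast
next
  fix i and v :: 'a assume i: "i \<ge> nat \<lceil>R / (\<rho> - norm c)\<rceil>" and v: "v \<in> {v. norm v \<le> R}"
  \<comment> \<open>From this index on, \<open>R + i * norm c \<le> \<rho> * i\<close>.\<close>
  have "R / (\<rho> - norm c) \<le> real i" using i by linarith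
  hence "R \<le> real i * (\<rho> - norm c)" using assms by (simp add: field_simps)
  hence "norm (v + of_nat i * c) \<le> \<rho> * real i"
    using v by (intro norm_triangle_le) (simp add: norm_mult algebra_simps)
  also have "\<dots> \<le> \<rho> * real (Suc i)"
    using assms order_le_less_trans[OF norm_ge_zero assms] by (intro mult_left_mono) auto
  finally have "norm (v + of_nat i * c) / real (Suc i) \<le> \<rho>" by (simp add: divide_le_eq)
  hence "norm (step_pochhammer c v i / fact i) * (norm (v + of_nat i * c) / real (Suc i))
     \<le> norm (step_pochhammer c v i / fact i) * \<rho>"
    by (rule mult_left_mono) simp
  moreover have "norm (step_pochhammer c v (Suc i) / fact (Suc i)) =
     norm (step_pochhammer c v i / fact i) * (norm (v + of_nat i * c) / real (Suc i))"
    by (simp only: step_pochhammer_Suc fact_Suc norm_mult norm_divide norm_of_nat norm_fact times_divide_times_eq mult_ac)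
  ultimately show "norm (step_pochhammer c v (Suc i) / fact (Suc i))
      \<le> \<rho> * norm (step_pochhammer c v i / fact i)"
    by (simp add: mult_ac)
qed

definition cm_weight :: "real \<Rightarrow> real \<Rightarrow> nat \<Rightarrow> real" where
  "cm_weight a b x = step_pochhammer b a x / fact x"

lemma cm_weight_pos: "a > 0 \<Longrightarrow> b \<ge> 0 \<Longrightarrow> cm_weight a b x > 0"
  by (simp add: cm_weight_def step_pochhammer_pos)

text \<open>
This identity and the next turn multiplication by \<open>x\<close> and by \<open>a + b x\<close> into a change of
the parameter from \<open>a\<close> to \<open>a + b\<close>, the first together with a shift of the argument.
\<close>
lemma cm_weight_Suc: "real (Suc x) * cm_weight a b (Suc x) = a * cm_weight (a + b) b x"
  by (simp add: cm_weight_def step_pochhammer_rec del: of_nat_Suc)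

lemma cm_weight_linear: "(a + b * real x) * cm_weight a b x = a * cm_weight (a + b) b x"
  using step_pochhammer_Suc[of b a x] step_pochhammer_rec[of b a x]
  by (simp add: cm_weight_def mult_ac)

lemma cm_weight_geometric_bound:
  assumes "0 \<le> b" "b < 1"
  obtains C \<rho> where "b < \<rho>" "\<rho> < 1" "\<And>x. \<bar>cm_weight a b x\<bar> \<le> C * \<rho> ^ x"
proof -
  obtain \<rho> where \<rho>: "b < \<rho>" "\<rho> < 1" using dense[OF assms(2)] by blast
  obtain C where "\<forall>i. \<forall>v\<in>{v. norm v \<le> \<bar>a\<bar>}. norm (step_pochhammer b v i / fact i) \<le> C * \<rho> ^ i"
    using step_pochhammer_geometric_bound[of b \<rho> "\<bar>a\<bar>"] \<rho> assms by auto
  hence "\<bar>cm_weight a b x\<bar> \<le> C * \<rho> ^ x" for x by (auto simp: cm_weight_def)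
  thus ?thesis using \<rho> that by blast
qed

lemma summable_cm_weight:
  assumes "0 \<le> b" "b < 1"
  shows "summable (cm_weight a b)"
proof -
  obtain C \<rho> where "b < \<rho>" "\<rho> < 1" and *: "\<And>x. \<bar>cm_weight a b x\<bar> \<le> C * \<rho> ^ x"
    using cm_weight_geometric_bound[OF assms] by metis
  show ?thesis
    by (rule summable_comparison_test[of _ "\<lambda>x. C * \<rho> ^ x"])
       (use * \<open>b < \<rho>\<close> \<open>\<rho> < 1\<close> assms in \<open>auto intro!: summable_mult summable_geometric\<close>)
qed

text \<open>
Write \<open>p (x) = c + x r (x)\<close>: the factor \<open>x\<close> is absorbed by the weight, so the series for \<open>x r (x)\<close>
is one for a polynomial of smaller degree with parameter \<open>a + b\<close>.
\<close>
lemma summable_poly_cm_weight: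
  assumes "0 \<le> b" "b < 1"
  shows "summable (\<lambda>x. poly p (real x) * cm_weight a b x)"
proof (induction "degree p" arbitrary: p a rule: less_induct)
  case less
  obtain c r where p: "p = pCons c r" by (cases p)
  have r: "summable (\<lambda>x. real x * poly r (real x) * cm_weight a b x)"
  proof (cases "r = 0")
    case False
    have "degree (r \<circ>\<^sub>p [:1, 1:]) < degree p"
      using False p by (simp add: degree_pcompose)
    from less[OF this, of "a + b"] have "summable (\<lambda>x. poly r (real (Suc x)) * cm_weight (a + b) b x)"
      by (simp add: poly_pcompose add.commute)
    hence "summable (\<lambda>x. a * (poly r (real (Suc x)) * cm_weight (a + b) b x))" by (rule summable_mult)
    also have "(\<lambda>x. a * (poly r (real (Suc x)) * cm_weight (a + b) b x)) =
        (\<lambda>x. real (Suc x) * poly r (real (Suc x)) * cm_weight a b (Suc x))"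
      using cm_weight_Suc[of _ a b] by (simp add: mult_ac fun_eq_iff del: of_nat_Suc)
    finally show ?thesis by (subst (asm) summable_Suc_iff)
  qed auto
  have "summable (\<lambda>x. c * cm_weight a b x + real x * poly r (real x) * cm_weight a b x)"
    by (intro summable_add summable_mult summable_cm_weight assms r)
  thus ?case by (simp add: p algebra_simps)
qed

definition cm_functional :: "real \<Rightarrow> real \<Rightarrow> real poly \<Rightarrow> real" where
  "cm_functional a b p = (\<Sum>x. poly p (real x) * cm_weight a b x)"

lemma cm_functional_0 [simp]: "cm_functional a b 0 = 0"
  by (simp add: cm_functional_def)

section \<open>Orthogonality\<close>

lemma degree_diff_less_of_same_lead:
  fixes p q :: "'a::ring_1 poly"
  assumes "degree p \<le> n" "degree q \<le> n" "coeff p n = coeff q n"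
  shows "p - q = 0 \<or> degree (p - q) < n"
proof (rule disjCI)
  assume "\<not> degree (p - q) < n"
  moreover have "degree (p - q) \<le> n" using assms by (intro degree_diff_le)
  ultimately have "degree (p - q) = n" by simp
  hence "lead_coeff (p - q) = 0" using assms by simp
  thus "p - q = 0" by (simp only: leading_coeff_0_iff)
qed

lemma forward_difference_degree:
  fixes q :: "real poly"
  assumes "degree q < Suc n"
  shows "q \<circ>\<^sub>p [:1, 1:] - q = 0 \<or> degree (q \<circ>\<^sub>p [:1, 1:] - q) < n"
proof -
  have "lead_coeff (q \<circ>\<^sub>p [:1, 1:]) = lead_coeff q" by (subst lead_coeff_comp) auto
  hence "coeff (q \<circ>\<^sub>p [:1, 1:]) (degree q) = coeff q (degree q)" by (simp add: degree_pcompose)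
  from degree_diff_less_of_same_lead[OF _ _ this]
  have "q \<circ>\<^sub>p [:1, 1:] - q = 0 \<or> degree (q \<circ>\<^sub>p [:1, 1:] - q) < degree q"
    by (simp add: degree_pcompose)
  thus ?thesis using assms order_less_le_trans[OF _ less_Suc_eq_le[THEN iffD1, OF assms]] by blast
qed

text \<open>
By the lowering relation this is the backward difference of \<open>cm_poly a b (Suc n)\<close>.
\<close>
definition cm_kernel :: "real \<Rightarrow> real \<Rightarrow> nat \<Rightarrow> real poly" where
  "cm_kernel a b n = smult (real (Suc n)) (cm_poly (a + b) b n \<circ>\<^sub>p [:-1, 1:])"

context
  fixes b :: real
  assumes b: "0 \<le> b" "b < 1"
begin

lemma cm_functional_add: "cm_functional a b (p + q) = cm_functional a b p + cm_functional a b q"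
  unfolding cm_functional_def
  by (subst suminf_add) (simp_all add: summable_poly_cm_weight b distrib_right)

lemma cm_functional_smult: "cm_functional a b (smult c p) = c * cm_functional a b p"
  unfolding cm_functional_def
  by (subst suminf_mult[symmetric]) (simp_all add: summable_poly_cm_weight b mult_ac)

lemma cm_functional_diff: "cm_functional a b (p - q) = cm_functional a b p - cm_functional a b q"
  using cm_functional_add[of a p "smult (-1) q"] cm_functional_smult[of a "-1" q] by simp

lemmas cm_functional_linear = cm_functional_add cm_functional_diff cm_functional_smult

lemma cm_functional_square_pos:
  assumes "a > 0" "p \<noteq> 0"
  shows "cm_functional a b (p * p) > 0"
proof -
  have "finite {x::nat. poly p (real x) = 0}"
    using finite_vimageI[OF poly_roots_finite[OF assms(2)], of real] by (simp add: vimage_def)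
  then obtain x :: nat where x: "poly p (real x) \<noteq> 0"
    using infinite_UNIV_nat by (metis (mono_tags) UNIV_eq_I mem_Collect_eq)
  have "cm_weight a b y \<ge> 0" for y
    using cm_weight_pos[OF assms(1) b(1), of y] by simp
  hence nonneg: "poly (p * p) (real y) * cm_weight a b y \<ge> 0" for y by simp
  show ?thesis unfolding cm_functional_def
  proof (rule suminf_pos2[where i = x])
    show "0 < poly (p * p) (real x) * cm_weight a b x"
      using x cm_weight_pos[OF assms(1) b(1), of x] 
      by (auto intro!: mult_pos_pos simp: zero_less_mult_iff)
  qed (use summable_poly_cm_weight[OF b] nonneg in blast)+
qed

lemma cm_functional_mult_X:
  "cm_functional a b (pCons 0 p) = a * cm_functional (a + b) b (p \<circ>\<^sub>p [:1, 1:])"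
proof -
  have "cm_functional a b (pCons 0 p) =
     (\<Sum>x. poly (pCons 0 p) (real (Suc x)) * cm_weight a b (Suc x))"
    unfolding cm_functional_def
    using suminf_split_head[OF summable_poly_cm_weight[OF b, of "pCons 0 p" a]] by simp
  also have "\<dots> = (\<Sum>x. a * (poly (p \<circ>\<^sub>p [:1, 1:]) (real x) * cm_weight (a + b) b x))"
  proof (rule suminf_cong)
    fix x
    have "poly (pCons 0 p) (real (Suc x)) * cm_weight a b (Suc x) =
        poly p (real (Suc x)) * (real (Suc x) * cm_weight a b (Suc x))"
      by (simp only: poly_pCons add_0_left mult_ac)
    thus "poly (pCons 0 p) (real (Suc x)) * cm_weight a b (Suc x) =
        a * (poly (p \<circ>\<^sub>p [:1, 1:]) (real x) * cm_weight (a + b) b x)"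
      unfolding cm_weight_Suc by (simp add: poly_pcompose add_ac mult_ac)
  qed
  also have "\<dots> = a * cm_functional (a + b) b (p \<circ>\<^sub>p [:1, 1:])"
    unfolding cm_functional_def by (intro suminf_mult summable_poly_cm_weight b)
  finally show ?thesis .
qed

lemma cm_functional_mult_linear:
  "cm_functional a b ([:a, b:] * p) = a * cm_functional (a + b) b p"
proof -
  have "poly ([:a, b:] * p) (real x) * cm_weight a b x = a * (poly p (real x) * cm_weight (a + b) b x)" for x
  proof -
    have "poly ([:a, b:] * p) (real x) * cm_weight a b x = poly p (real x) * ((a + b * real x) * cm_weight a b x)"
      by (simp add: algebra_simps)
    thus ?thesis unfolding cm_weight_linear by simp
  qed
  thus ?thesis
    unfolding cm_functional_def by (simp add: suminf_mult summable_poly_cm_weight b)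
qed

text \<open>
Evaluate the functional at \<open>a + b x\<close> in two ways: by linearity, and by absorbing the
linear factor into the weight.
\<close>
lemma cm_functional_mass_shift: "a > 0 \<Longrightarrow> (1 - b) * cm_functional (a + b) b 1 = cm_functional a b 1"
proof -
  assume "a > 0"
  have "[:a, b:] * 1 = smult a 1 + smult b (pCons 0 1)" by simp
  hence "cm_functional a b ([:a, b:] * 1) = a * cm_functional a b 1 + b * cm_functional a b (pCons 0 1)"
    by (simp only: cm_functional_linear)
  hence "a * cm_functional (a + b) b 1 = a * (cm_functional a b 1 + b * cm_functional (a + b) b 1)"
    unfolding cm_functional_mult_linear cm_functional_mult_X pcompose_1
    by (simp only: distrib_left mult_ac)
  hence "cm_functional (a + b) b 1 = cm_functional a b 1 + b * cm_functional (a + b) b 1"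
    using \<open>a > 0\<close> by (metis mult_left_cancel less_irrefl)
  thus ?thesis by (simp add: algebra_simps)
qed

lemma cm_poly_raising:
  "smult (1 - b) (cm_poly a b (Suc n)) =
     pCons 0 (cm_poly (a + b) b n \<circ>\<^sub>p [:-1, 1:]) - [:a, b:] * cm_poly (a + b) b n"
  using b cm_value_raising[of b a n]
  by (subst poly_eq_poly_eq_iff[symmetric]) (simp add: fun_eq_iff poly_cm_poly poly_pcompose algebra_simps)

lemma cm_poly_difference:
  "cm_poly a b (Suc n) \<circ>\<^sub>p [:1, 1:] - cm_poly a b (Suc n) = smult (real (Suc n)) (cm_poly (a + b) b n)"
  using b cm_value_difference[of b a n]
  by (subst poly_eq_poly_eq_iff[symmetric])
     (simp add: fun_eq_iff poly_cm_poly poly_pcompose add.commute[of 1] del: of_nat_Suc)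

text \<open>
Summation by parts, with the boundary terms already handled by the shift identities: the raising
relation is adjoint to the forward difference.  Orthogonality and the norms follow by
induction on the degree, with varying \<open>a\<close>.
\<close>
lemma cm_functional_raising:
  "(1 - b) * cm_functional a b (cm_poly a b (Suc n) * q) =
     a * cm_functional (a + b) b (cm_poly (a + b) b n * (q \<circ>\<^sub>p [:1, 1:] - q))"
proof -
  let ?P = "cm_poly (a + b) b n"
  have shift: "(?P \<circ>\<^sub>p [:-1, 1:]) \<circ>\<^sub>p [:1, 1:] = ?P"
    by (simp add: pcompose_assoc[symmetric] pcompose_pCons)
  have "(1 - b) * cm_functional a b (cm_poly a b (Suc n) * q) =
      cm_functional a b (smult (1 - b) (cm_poly a b (Suc n)) * q)"
    by (simp add: cm_functional_smult)
  also have "smult (1 - b) (cm_poly a b (Suc n)) * q =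
      pCons 0 ((?P \<circ>\<^sub>p [:-1, 1:]) * q) - [:a, b:] * (?P * q)"
  proof -
    have "(pCons 0 X - Y * Z) * q = pCons 0 (X * q) - Y * (Z * q)" for X Y Z :: "real poly"
      by (simp add: left_diff_distrib mult.assoc)
    thus ?thesis unfolding cm_poly_raising .
  qed
  also have "cm_functional a b \<dots> =
      a * cm_functional (a + b) b (?P * (q \<circ>\<^sub>p [:1, 1:])) - a * cm_functional (a + b) b (?P * q)"
    unfolding cm_functional_diff cm_functional_mult_linear cm_functional_mult_X pcompose_mult shift ..
  also have "\<dots> = a * cm_functional (a + b) b (?P * (q \<circ>\<^sub>p [:1, 1:] - q))"
    by (simp add: right_diff_distrib cm_functional_diff)
  finally show ?thesis .
qed

lemma cm_poly_orthogonal: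
  assumes "q = 0 \<or> degree q < n"
  shows "cm_functional a b (cm_poly a b n * q) = 0"
  using assms
proof (induction n arbitrary: a q)
  case (Suc n)
  have "q \<circ>\<^sub>p [:1, 1:] - q = 0 \<or> degree (q \<circ>\<^sub>p [:1, 1:] - q) < n"
    using Suc.prems forward_difference_degree[of q n] by auto
  hence "(1 - b) * cm_functional a b (cm_poly a b (Suc n) * q) = 0"
    unfolding cm_functional_raising by (simp add: Suc.IH)
  thus ?case using b by simp
qed auto

lemma cm_poly_at_0: "(1 - b) ^ n * poly (cm_poly a b n) 0 = (- 1) ^ n * step_pochhammer b a n"
proof (induction n arbitrary: a)
  case (Suc n)
  have "(1 - b) * poly (cm_poly a b (Suc n)) 0 = - a * poly (cm_poly (a + b) b n) 0"
    using cm_value_raising[of b a n 0] b by (simp add: poly_cm_poly)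
  hence "(1 - b) ^ Suc n * poly (cm_poly a b (Suc n)) 0 = - a * ((1 - b) ^ n * poly (cm_poly (a + b) b n) 0)"
    by (metis (no_types, lifting) mult.left_commute power_Suc2 mult.assoc)
  thus ?case unfolding Suc.IH by (simp add: step_pochhammer_rec)
qed (simp add: cm_poly_def)

text \<open>
Take the raising identity at the polynomial itself: its difference is a multiple of the polynomial of
degree \<open>n\<close> for the parameter \<open>a + b\<close>, so the norms obey a recursion; the total mass is
moved back from \<open>a + b\<close> to \<open>a\<close> at each step.
\<close>
lemma cm_poly_norm:
  assumes "a > 0"
  shows "(1 - b) ^ (2 * n) * cm_functional a b (cm_poly a b n * cm_poly a b n) =
     fact n * step_pochhammer b a n * cm_functional a b 1"
  using assms
proof (induction n arbitrary: a)
  case (Suc n)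
  have "(1 - b) * cm_functional a b (cm_poly a b (Suc n) * cm_poly a b (Suc n)) =
      a * real (Suc n) * cm_functional (a + b) b (cm_poly (a + b) b n * cm_poly (a + b) b n)"
    unfolding cm_functional_raising cm_poly_difference by (simp add: cm_functional_smult del: of_nat_Suc)
  hence "(1 - b) ^ (2 * Suc n) * cm_functional a b (cm_poly a b (Suc n) * cm_poly a b (Suc n)) =
      (1 - b) * (a * real (Suc n)) * ((1 - b) ^ (2 * n) * cm_functional (a + b) b (cm_poly (a + b) b n * cm_poly (a + b) b n))"
    by (simp add: mult_ac)
  also have "\<dots> = a * real (Suc n) * fact n * step_pochhammer b (a + b) n * ((1 - b) * cm_functional (a + b) b 1)"
    using Suc.prems b by (subst Suc.IH) (auto simp: mult_ac)
  also have "\<dots> = fact (Suc n) * step_pochhammer b a (Suc n) * cm_functional a b 1"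
    unfolding cm_functional_mass_shift[OF Suc.prems] by (simp add: step_pochhammer_rec del: of_nat_Suc)
  finally show ?case .
qed (simp add: cm_poly_def)

section \<open>The effect of a mass at the origin\<close>

lemma degree_cm_kernel: "degree (cm_kernel a b n) = n"
  by (simp add: cm_kernel_def degree_pcompose del: of_nat_Suc)

lemma coeff_cm_kernel: "coeff (cm_kernel a b n) n = real (Suc n)"
proof -
  have "lead_coeff (cm_poly (a + b) b n \<circ>\<^sub>p [:-1, 1:]) = 1"
    by (subst lead_coeff_comp) auto
  thus ?thesis by (simp add: cm_kernel_def degree_pcompose del: of_nat_Suc)
qed

text \<open>
Write \<open>q = q(0) + x r\<close>.  Absorbing \<open>x\<close> into the weight shifts the kernel to the orthogonal polynomial
of degree \<open>n\<close> for the parameter \<open>a + b\<close>, which annihilates the shift of \<open>r\<close>.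
\<close>
lemma cm_kernel_reproducing:
  assumes "degree q \<le> n"
  shows "cm_functional a b (cm_kernel a b n * q) = cm_functional a b (cm_kernel a b n) * poly q 0"
proof -
  obtain c r where q: "q = pCons c r" by (cases q)
  have "cm_kernel a b n \<circ>\<^sub>p [:1, 1:] = smult (real (Suc n)) (cm_poly (a + b) b n)"
    by (simp add: cm_kernel_def pcompose_smult pcompose_assoc[symmetric] pcompose_pCons)
  moreover have "r \<circ>\<^sub>p [:1, 1:] = 0 \<or> degree (r \<circ>\<^sub>p [:1, 1:]) < n"
    using assms q by (cases "r = 0") (auto simp: degree_pcompose)
  ultimately have "cm_functional a b (pCons 0 (cm_kernel a b n * r)) = 0"
    unfolding cm_functional_mult_X pcompose_mult by (simp add: cm_functional_smult cm_poly_orthogonal)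
  moreover have "cm_kernel a b n * q = smult c (cm_kernel a b n) + pCons 0 (cm_kernel a b n * r)"
    by (simp add: q)
  ultimately show ?thesis by (simp add: cm_functional_linear q)
qed

text \<open>
Evaluating the pairing of the kernel with \<open>cm_poly a b n\<close> in a second way, through its leading
coefficient \<open>n + 1\<close>, determines the constant in the reproducing property.
\<close>
lemma cm_kernel_mass:
  "cm_functional a b (cm_kernel a b n) * poly (cm_poly a b n) 0 =
     real (Suc n) * cm_functional a b (cm_poly a b n * cm_poly a b n)"
proof -
  define r where "r = cm_kernel a b n - smult (real (Suc n)) (cm_poly a b n)"
  have "r = 0 \<or> degree r < n"
    unfolding r_def using degree_cm_kernel coeff_cm_kernel
    by (intro degree_diff_less_of_same_lead) (auto intro!: order.trans[OF degree_smult_le] simp del: of_nat_Suc)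
  hence "cm_functional a b (cm_poly a b n * r) = 0" by (rule cm_poly_orthogonal)
  moreover have "cm_kernel a b n * cm_poly a b n = cm_poly a b n * r + smult (real (Suc n)) (cm_poly a b n * cm_poly a b n)"
    by (simp add: r_def algebra_simps)
  ultimately show ?thesis
    using cm_kernel_reproducing[of "cm_poly a b n" n a] by (simp add: cm_functional_linear del: of_nat_Suc)
qed

text \<open>
With \<open>\<kappa>\<close> the constant of the reproducing property, the difference \<open>p - P (n + 1)\<close> pairs with \<open>q\<close> of
degree at most \<open>n\<close> to \<open>- B p(0) q(0)\<close>, just as \<open>- (B p(0) / \<kappa>)\<close> times the kernel does; both have
degree at most \<open>n\<close>, so they agree.  For the bound, evaluation at \<open>0\<close> gives an
equation for \<open>c\<close> in which \<open>B \<ge> 0\<close> can only enlarge the coefficient of \<open>c\<close>; hence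
\<open>\<bar>c \<kappa>\<bar> \<le> B \<bar>P (n + 1) (0)\<bar>\<close>, and the explicit norm and the values at \<open>0\<close> do the rest.
\<close>
lemma mass_modified_eq:
  assumes a: "a > 0" and B: "B \<ge> 0"
    and p: "degree p = Suc n" "coeff p (Suc n) = 1"
    and orth: "\<And>q. degree q \<le> n \<Longrightarrow> cm_functional a b (p * q) + B * poly p 0 * poly q 0 = 0"
  shows "\<exists>c. p = cm_poly a b (Suc n) - smult c (cm_kernel a b n) \<and>
     \<bar>c\<bar> * ((1 - b) * cm_functional a b 1) \<le> B * cm_weight a b (Suc n)"
proof -
  let ?L = "cm_functional a b" and ?P = "cm_poly a b" and ?D = "cm_kernel a b n"
  define \<kappa> where "\<kappa> = ?L ?D"
  have mass: "\<kappa> * poly (?P n) 0 = real (Suc n) * ?L (?P n * ?P n)"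
    unfolding \<kappa>_def by (rule cm_kernel_mass)
  have "?P n \<noteq> 0" using lead_coeff_cm_poly[of a b n] by (metis coeff_0 zero_neq_one)
  hence norm_pos: "?L (?P n * ?P n) > 0" by (rule cm_functional_square_pos[OF a])
  hence \<kappa>: "\<kappa> \<noteq> 0" using mass by auto
  define E where "E = smult \<kappa> (p - ?P (Suc n)) + smult (B * poly p 0) ?D"
  have "p - ?P (Suc n) = 0 \<or> degree (p - ?P (Suc n)) < Suc n"
    using p by (intro degree_diff_less_of_same_lead) auto
  hence "degree (p - ?P (Suc n)) \<le> n" by auto
  hence degE: "degree E \<le> n"
    unfolding E_def using degree_cm_kernel[of a n]
    by (intro degree_add_le order.trans[OF degree_smult_le]) auto
  have "E * E = smult \<kappa> (p * E) - smult \<kappa> (?P (Suc n) * E) + smult (B * poly p 0) (?D * E)"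
    by (simp add: E_def algebra_simps smult_add_right smult_diff_right)
  hence "?L (E * E) = \<kappa> * ?L (p * E) - \<kappa> * ?L (?P (Suc n) * E) + B * poly p 0 * ?L (?D * E)"
    by (simp only: cm_functional_linear)
  also have "?L (?P (Suc n) * E) = 0" using degE by (intro cm_poly_orthogonal) auto
  also have "?L (?D * E) = \<kappa> * poly E 0" unfolding \<kappa>_def by (rule cm_kernel_reproducing[OF degE])
  also have "?L (p * E) = - (B * poly p 0 * poly E 0)" using orth[OF degE] by simp
  finally have "?L (E * E) = 0" by simp
  hence E0: "E = 0" using cm_functional_square_pos[OF a, of E] by force
  define c where "c = B * poly p 0 / \<kappa>"
  have "smult \<kappa> (p - ?P (Suc n) + smult c ?D) = E"
    using \<kappa> by (simp add: E_def c_def smult_add_right)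
  hence "p - ?P (Suc n) + smult c ?D = 0" using E0 \<kappa> by simp
  hence peq: "p = ?P (Suc n) - smult c ?D" by (simp add: algebra_simps)
  \<comment> \<open>The kernel reproduces itself, so \<open>\<kappa>\<close> and its value at \<open>0\<close> have the same sign.\<close>
  have "\<kappa> * poly ?D 0 = ?L (?D * ?D)"
    unfolding \<kappa>_def using cm_kernel_reproducing[of ?D n a] degree_cm_kernel[of a n] by simp
  hence D_nonneg: "\<kappa> * poly ?D 0 \<ge> 0"
    using cm_functional_square_pos[OF a, of ?D] by (cases "?D = 0") auto
  have "c * \<kappa> = B * (poly (?P (Suc n)) 0 - c * poly ?D 0)"
    using \<kappa> arg_cong[OF peq, of "\<lambda>p. poly p 0"] by (simp add: c_def)
  note c_eq = this
  have "c * (\<kappa>\<^sup>2 + B * (\<kappa> * poly ?D 0)) = \<kappa> * (c * \<kappa>) + \<kappa> * B * (c * poly ?D 0)"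
    by (simp add: power2_eq_square algebra_simps)
  also have "\<dots> = \<kappa> * B * poly (?P (Suc n)) 0"
    unfolding c_eq by (simp add: algebra_simps)
  finally have "c * (\<kappa>\<^sup>2 + B * (\<kappa> * poly ?D 0)) = \<kappa> * B * poly (?P (Suc n)) 0" .
  hence "\<bar>c\<bar> * \<bar>\<kappa>\<^sup>2 + B * (\<kappa> * poly ?D 0)\<bar> = \<bar>\<kappa>\<bar> * B * \<bar>poly (?P (Suc n)) 0\<bar>"
    using B by (metis abs_mult abs_of_nonneg)
  moreover have "\<kappa>\<^sup>2 \<le> \<bar>\<kappa>\<^sup>2 + B * (\<kappa> * poly ?D 0)\<bar>"
    using mult_nonneg_nonneg[OF B D_nonneg] by (simp add: abs_le_iff)
  ultimately have "\<bar>c\<bar> * \<kappa>\<^sup>2 \<le> \<bar>\<kappa>\<bar> * B * \<bar>poly (?P (Suc n)) 0\<bar>"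
    by (metis abs_ge_zero mult_left_mono)
  moreover have "\<kappa>\<^sup>2 = \<bar>\<kappa>\<bar> * \<bar>\<kappa>\<bar>" by (simp add: power2_eq_square)
  ultimately have "\<bar>\<kappa>\<bar> * (\<bar>c\<bar> * \<bar>\<kappa>\<bar>) \<le> \<bar>\<kappa>\<bar> * (B * \<bar>poly (?P (Suc n)) 0\<bar>)"
    by (simp only: mult_ac)
  hence "\<bar>c\<bar> * \<bar>\<kappa>\<bar> \<le> B * \<bar>poly (?P (Suc n)) 0\<bar>" using \<kappa> by simp
  hence "\<bar>c\<bar> * \<bar>\<kappa>\<bar> * \<bar>poly (?P n) 0\<bar> \<le> B * \<bar>poly (?P (Suc n)) 0\<bar> * \<bar>poly (?P n) 0\<bar>"
    by (rule mult_right_mono) simp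
  moreover have "\<bar>\<kappa>\<bar> * \<bar>poly (?P n) 0\<bar> = real (Suc n) * ?L (?P n * ?P n)"
    using mass norm_pos by (simp add: abs_mult[symmetric])
  ultimately have key: "\<bar>c\<bar> * (real (Suc n) * ?L (?P n * ?P n)) \<le> B * \<bar>poly (?P (Suc n)) 0\<bar> * \<bar>poly (?P n) 0\<bar>"
    by (simp only: mult.assoc)
  let ?s = "step_pochhammer b a"
  have s: "?s m > 0" for m by (rule step_pochhammer_pos[OF a b(1)])
  have P0: "(1 - b) ^ m * \<bar>poly (?P m) 0\<bar> = ?s m" for m
    using arg_cong[OF cm_poly_at_0[of m a], of abs] b s[of m] by (simp add: abs_mult power_abs)
  \<comment> \<open>The power of \<open>1 - b\<close> is the total denominator of the two values at \<open>0\<close>.\<close>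
  have "(1 - b) ^ (2 * n + 1) * (\<bar>c\<bar> * (real (Suc n) * ?L (?P n * ?P n)))
     \<le> (1 - b) ^ (2 * n + 1) * (B * \<bar>poly (?P (Suc n)) 0\<bar> * \<bar>poly (?P n) 0\<bar>)"
    using b by (intro mult_left_mono[OF key]) auto
  also have "\<dots> = B * ((1 - b) ^ Suc n * \<bar>poly (?P (Suc n)) 0\<bar>) * ((1 - b) ^ n * \<bar>poly (?P n) 0\<bar>)"
    by (simp add: power_add mult_2_right mult_ac)
  also have "\<dots> = B * ?s (Suc n) * ?s n" unfolding P0 ..
  also have "(1 - b) ^ (2 * n + 1) * (\<bar>c\<bar> * (real (Suc n) * ?L (?P n * ?P n))) =
     (1 - b) * \<bar>c\<bar> * real (Suc n) * ((1 - b) ^ (2 * n) * ?L (?P n * ?P n))"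
    by (simp add: mult_ac)
  also have "\<dots> = \<bar>c\<bar> * ((1 - b) * ?L 1) * fact (Suc n) * ?s n"
    unfolding cm_poly_norm[OF a] by (simp add: algebra_simps)
  finally have "\<bar>c\<bar> * ((1 - b) * ?L 1) * fact (Suc n) \<le> B * ?s (Suc n)"
    using s[of n] by simp
  hence "\<bar>c\<bar> * ((1 - b) * ?L 1) \<le> B * cm_weight a b (Suc n)"
    by (simp add: cm_weight_def pos_le_divide_eq del: fact_Suc)
  thus ?thesis using peq by blast
qed

text \<open>
The monic polynomials of all degrees span: subtracting the right multiple of \<open>C m\<close> lowers
the degree \<open>m\<close> of \<open>q\<close>.
\<close>
lemma orthogonal_to_lower_degree:
  assumes deg: "\<And>n. degree (C n) = n" "\<And>n. coeff (C n) n = 1"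
    and orth: "\<And>m n. m \<noteq> n \<Longrightarrow> cm_functional a b (C m * C n) + B * poly (C m) 0 * poly (C n) 0 = 0"
    and "degree q < n"
  shows "cm_functional a b (C n * q) + B * poly (C n) 0 * poly q 0 = 0"
  using \<open>degree q < n\<close>
proof (induction "degree q" arbitrary: q rule: less_induct)
  case less
  define m where "m = degree q"
  define r where "r = q - smult (coeff q m) (C m)"
  have r: "r = 0 \<or> degree r < m"
    unfolding r_def using deg by (intro degree_diff_less_of_same_lead)
      (auto simp: m_def intro!: order.trans[OF degree_smult_le])
  have "cm_functional a b (C n * r) + B * poly (C n) 0 * poly r 0 = 0"
    using r less.hyps[of r] less.prems by (auto simp: m_def)
  moreover have "cm_functional a b (C n * C m) + B * poly (C n) 0 * poly (C m) 0 = 0"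
    using less.prems by (intro orth) (auto simp: m_def)
  moreover have eqs: "C n * q = C n * r + smult (coeff q m) (C n * C m)"
      "poly q 0 = poly r 0 + coeff q m * poly (C m) 0"
    by (simp_all add: r_def algebra_simps)
  have "cm_functional a b (C n * q) + B * poly (C n) 0 * poly q 0 =
      (cm_functional a b (C n * r) + B * poly (C n) 0 * poly r 0)
      + coeff q m * (cm_functional a b (C n * C m) + B * poly (C n) 0 * poly (C m) 0)"
    unfolding eqs cm_functional_linear by (simp add: algebra_simps)
  ultimately show ?case by simp
qed

end

section \<open>Dominated series and ratios of Gamma values\<close>

text \<open>
Tannery's theorem with a parameter: the dominating series makes the tails small for all \<open>n\<close>
and \<open>z\<close> at once, and the remaining finite sum converges uniformly.
\<close>
lemma uniform_limit_suminf_dominated: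
  fixes f :: "nat \<Rightarrow> nat \<Rightarrow> 'b \<Rightarrow> 'c::banach"
  assumes lim: "\<And>i. uniform_limit K (\<lambda>n. f n i) (g i) sequentially"
    and bound: "\<And>n i z. z \<in> K \<Longrightarrow> norm (f n i z) \<le> M i"
    and M: "summable M"
  shows "uniform_limit K (\<lambda>n z. \<Sum>i. f n i z) (\<lambda>z. \<Sum>i. g i z) sequentially"
proof (rule uniform_limitI)
  fix e :: real assume e: "e > 0"
  have g_bound: "norm (g i z) \<le> M i" if z: "z \<in> K" for i z
  proof (rule LIMSEQ_le_const2)
    show "(\<lambda>n. norm (f n i z)) \<longlonglongrightarrow> norm (g i z)"
      using tendsto_uniform_limitI[OF lim z] by (rule tendsto_norm)
  qed (use bound[OF z] in blast)
  have sf: "summable (\<lambda>i. f n i z)" and sg: "summable (\<lambda>i. g i z)" if "z \<in> K" for n z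
    using that by (auto intro!: summable_comparison_test[OF _ M] bound g_bound)
  have "(\<lambda>N. \<Sum>i. M (i + N)) \<longlonglongrightarrow> 0" by (rule suminf_exist_split2[OF M])
  hence "\<forall>\<^sub>F N in sequentially. (\<Sum>i. M (i + N)) < e / 4"
    using e by (intro order_tendstoD) auto
  then obtain N where N: "(\<Sum>i. M (i + N)) < e / 4"
    using eventually_happens'[OF sequentially_bot] by blast
  have "uniform_limit K (\<lambda>n z. \<Sum>i<N. f n i z) (\<lambda>z. \<Sum>i<N. g i z) sequentially"
    by (induction N) (auto intro!: uniform_limit_intros lim)
  hence "\<forall>\<^sub>F n in sequentially. \<forall>z\<in>K. dist (\<Sum>i<N. f n i z) (\<Sum>i<N. g i z) < e / 2"
    using e by (intro uniform_limitD) auto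
  thus "\<forall>\<^sub>F n in sequentially. \<forall>z\<in>K. dist (\<Sum>i. f n i z) (\<Sum>i. g i z) < e"
  proof eventually_elim
    case (elim n)
    show ?case
    proof
      fix z assume z: "z \<in> K"
      have tail: "norm (\<Sum>i. u (i + N)) < e / 4" if "\<And>i. norm (u i) \<le> M i" for u :: "nat \<Rightarrow> 'c"
        using norm_suminf_le[OF that summable_ignore_initial_segment[OF M]] N
        by (rule le_less_trans)
      have "dist (\<Sum>i. f n i z) (\<Sum>i. g i z) =
         norm (((\<Sum>i<N. f n i z) - (\<Sum>i<N. g i z)) + ((\<Sum>i. f n (i + N) z) - (\<Sum>i. g (i + N) z)))"
        using suminf_split_initial_segment[OF sf[OF z], of n N] suminf_split_initial_segment[OF sg[OF z], of N]
        by (simp add: dist_norm algebra_simps)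
      also have "\<dots> \<le> dist (\<Sum>i<N. f n i z) (\<Sum>i<N. g i z) +
          (norm (\<Sum>i. f n (i + N) z) + norm (\<Sum>i. g (i + N) z))"
        unfolding dist_norm by (intro norm_triangle_le add_mono norm_triangle_ineq4 order_refl)
      also have "\<dots> < e / 2 + (e / 4 + e / 4)"
        using elim z by (intro add_strict_mono tail bound g_bound) auto
      finally show "dist (\<Sum>i. f n i z) (\<Sum>i. g i z) < e" by simp
    qed
  qed
qed

lemma filterlim_minus_const_nat: "filterlim (\<lambda>n. n - k :: nat) sequentially sequentially"
  unfolding filterlim_at_top
proof
  fix N show "\<forall>\<^sub>F n in sequentially. N \<le> n - k"
    by (rule eventually_sequentiallyI[of "N + k"]) simp
qed

lemma eventually_of_nat_gt: "\<forall>\<^sub>F n in sequentially. real n > R"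
  using filterlim_real_sequentially by (simp add: filterlim_at_top_dense)

lemma continuous_on_rGamma_compose:
  "continuous_on K f \<Longrightarrow> continuous_on K (\<lambda>z. rGamma (f z :: complex))"
  by (rule continuous_on_compose2[OF continuous_on_rGamma]) auto

text \<open>
Where the Gamma values exist this is \<open>\<Gamma>(m - z) / (\<Gamma>(- z) \<Gamma>(n - z)) * n! / m!\<close>.
The form without quotients of Gamma functions is entire in \<open>z\<close>, so that compact sets meeting the
nonnegative integers need no special treatment.
\<close>
definition gamma_ratio :: "nat \<Rightarrow> nat \<Rightarrow> complex \<Rightarrow> complex" where
  "gamma_ratio n m z = fact n * rGamma (of_nat n - z) * (pochhammer (- z) m / fact m)"

lemma gamma_ratio_same: "gamma_ratio n n z = rGamma (- z)"
  using pochhammer_rGamma[of "- z" n] by (simp add: gamma_ratio_def add.commute)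

lemma gamma_ratio_Suc_left:
  "gamma_ratio (Suc n) m z * (of_nat n - z) = gamma_ratio n m z * of_nat (Suc n)"
proof -
  have "rGamma (of_nat n - z) = (of_nat n - z) * rGamma (of_nat (Suc n) - z)"
    using rGamma_plus1[of "of_nat n - z"] by (simp add: algebra_simps)
  thus ?thesis by (simp add: gamma_ratio_def mult_ac)
qed

lemma gamma_ratio_Suc_right:
  "gamma_ratio n m z * (of_nat m - z) = gamma_ratio n (Suc m) z * of_nat (Suc m)"
  by (simp add: gamma_ratio_def pochhammer_Suc field_simps del: of_nat_Suc)

lemma continuous_on_gamma_ratio: "continuous_on K (gamma_ratio n m)"
  unfolding gamma_ratio_def pochhammer_prod by (intro continuous_intros continuous_on_rGamma_compose) auto

lemma compact_continuous_bound:
  fixes f :: "'a::topological_space \<Rightarrow> 'b::real_normed_vector"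
  assumes "compact K" "continuous_on K f"
  shows "\<exists>B. \<forall>z\<in>K. norm (f z) \<le> B"
  using compact_imp_bounded[OF compact_continuous_image[OF assms(2,1)]]
  by (auto simp: bounded_iff)

text \<open>
For fixed \<open>m\<close>, passing from \<open>n\<close> to \<open>n + 1\<close> multiplies the ratio by \<open>(n + 1) / (n - z)\<close>,
which is at most \<open>q\<close> in modulus once \<open>n \<ge> J\<close>, uniformly on \<open>K\<close>.  The start \<open>n = m\<close> is \<open>1 / \<Gamma>(- z)\<close>
for every \<open>m\<close>, and below \<open>J\<close> only finitely many continuous functions occur; there division by
\<open>n - z\<close> would be illegitimate.
\<close>
lemma gamma_ratio_bound:
  assumes K: "compact K" and q: "q > 1"
  shows "\<exists>C. \<forall>n m. \<forall>z\<in>K. m \<le> n \<longrightarrow> norm (gamma_ratio n m z) \<le> C * q ^ (n - m)"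
proof -
  obtain R where R: "\<And>z. z \<in> K \<Longrightarrow> norm z \<le> R"
    using compact_imp_bounded[OF K] by (auto simp: bounded_iff)
  obtain B where B: "\<And>n m z. z \<in> K \<Longrightarrow> norm (gamma_ratio n m z) \<le> B n m"
    using compact_continuous_bound[OF K continuous_on_gamma_ratio] by metis
  \<comment> \<open>For \<open>n \<ge> J\<close> one has \<open>n + 1 \<le> q * (n - R)\<close>.\<close>
  define J where "J = nat \<lceil>(1 + q * R) / (q - 1)\<rceil>"
  \<comment> \<open>\<open>B 0 0\<close> bounds \<open>rGamma (- z)\<close>, the common value on the diagonal.\<close>
  define C where "C = \<bar>B 0 0\<bar> + (\<Sum>n\<le>J. \<Sum>m\<le>J. \<bar>B n m\<bar>)"
  have C: "\<bar>B n m\<bar> \<le> C" if "n \<le> J" "m \<le> J" for n m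
  proof -
    have "\<bar>B n m\<bar> \<le> (\<Sum>m\<le>J. \<bar>B n m\<bar>)" using that by (intro member_le_sum) auto
    also have "\<dots> \<le> (\<Sum>n\<le>J. \<Sum>m\<le>J. \<bar>B n m\<bar>)"
      using that by (intro member_le_sum[of n _ "\<lambda>n. \<Sum>m\<le>J. \<bar>B n m\<bar>"]) (auto intro!: sum_nonneg)
    finally show ?thesis by (simp add: C_def)
  qed
  have "C \<ge> 0" using C[of 0 0] by simp
  have "norm (gamma_ratio n m z) \<le> C * q ^ (n - m)" if z: "z \<in> K" and "m \<le> n" for n m z
    using \<open>m \<le> n\<close>
  proof (induction n rule: dec_induct)
    case base
    have "norm (gamma_ratio m m z) \<le> \<bar>B 0 0\<bar>"
      using B[OF z, of 0 0] unfolding gamma_ratio_same by linarith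
    also have "\<dots> \<le> C" by (simp add: C_def sum_nonneg)
    finally show ?case by simp
  next
    case (step n)
    show ?case
    proof (cases "n \<ge> J")
      case True
      hence "(1 + q * R) / (q - 1) \<le> real n" unfolding J_def by linarith
      hence "real (Suc n) \<le> q * (real n - R)" using q by (simp add: field_simps)
      also have "\<dots> \<le> q * norm (of_nat n - z)"
        using R[OF z] q norm_triangle_ineq2[of "of_nat n" z] by (intro mult_left_mono) auto
      finally have le: "real (Suc n) \<le> q * norm (of_nat n - z)" .
      have "norm (of_nat n - z) \<noteq> 0" using le by (intro notI) auto
      hence pos: "norm (of_nat n - z) > 0" by simp
      have "norm (gamma_ratio (Suc n) m z) * norm (of_nat n - z) = norm (gamma_ratio n m z) * real (Suc n)"
        using arg_cong[OF gamma_ratio_Suc_left[of n m z], of norm]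
        by (simp only: norm_mult norm_of_nat)
      also have "\<dots> \<le> (C * q ^ (n - m)) * (q * norm (of_nat n - z))"
        using \<open>C \<ge> 0\<close> q by (intro mult_mono step.IH le) auto
      also have "\<dots> = (C * q ^ (Suc n - m)) * norm (of_nat n - z)"
        using step.hyps by (simp add: Suc_diff_le)
      finally show ?thesis using pos by simp
    next
      case False
      hence "norm (gamma_ratio (Suc n) m z) \<le> C"
        using C[of "Suc n" m] B[OF z, of "Suc n" m] step.hyps by linarith
      also have "\<dots> \<le> C * q ^ (Suc n - m)"
        using mult_left_mono[of 1 "q ^ (Suc n - m)" C] \<open>C \<ge> 0\<close> q by simp
      finally show ?thesis .
    qed
  qed
  thus ?thesis by blast
qed

lemma uniform_limit_shift_quotient:
  fixes K :: "complex set"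
  assumes "bounded K"
  shows "uniform_limit K (\<lambda>m z. of_nat (Suc m) / (of_nat m - z)) (\<lambda>_. 1) sequentially"
proof (rule uniform_limitI)
  fix e :: real assume e: "e > 0"
  obtain R where R: "\<And>z. z \<in> K \<Longrightarrow> norm z \<le> R"
    using assms by (auto simp: bounded_iff)
  have "(\<lambda>m. (1 + R) / (real m - R)) \<longlonglongrightarrow> 0" by real_asymp
  hence "\<forall>\<^sub>F m in sequentially. (1 + R) / (real m - R) < e"
    using e by (intro order_tendstoD) auto
  moreover have "\<forall>\<^sub>F m in sequentially. real m > R"
    by (rule eventually_of_nat_gt)
  ultimately show "\<forall>\<^sub>F m in sequentially. \<forall>z\<in>K. dist (of_nat (Suc m) / (of_nat m - z)) 1 < e"
  proof eventually_elim
    case (elim m)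
    show ?case
    proof
      fix z assume z: "z \<in> K"
      have le: "real m - R \<le> norm (of_nat m - z)"
        using norm_triangle_ineq2[of "of_nat m" z] R[OF z] by simp
      hence nz: "of_nat m - z \<noteq> 0" using elim by auto
      have "of_nat (Suc m) / (of_nat m - z) - 1 = (1 + z) / (of_nat m - z)"
        using nz by (simp add: field_simps)
      hence "dist (of_nat (Suc m) / (of_nat m - z)) 1 = norm (1 + z) / norm (of_nat m - z)"
        by (simp only: dist_norm norm_divide)
      also have "\<dots> \<le> (1 + R) / (real m - R)"
      proof (rule frac_le)
        show *: "norm (1 + z) \<le> 1 + R"
          using R[OF z] norm_triangle_ineq[of 1 z] by simp
        show "0 \<le> 1 + R" using order_trans[OF norm_ge_zero *] .
      qed (use le elim in auto)
      also have "\<dots> < e" using elim by simp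
      finally show "dist (of_nat (Suc m) / (of_nat m - z)) 1 < e" .
    qed
  qed
qed

text \<open>
Induction on \<open>i\<close>: lowering \<open>m = n - i\<close> by one multiplies the ratio by a quotient that tends to \<open>1\<close>.
\<close>
lemma uniform_limit_gamma_ratio:
  assumes K: "compact K"
  shows "uniform_limit K (\<lambda>n. gamma_ratio n (n - i)) (\<lambda>z. rGamma (- z)) sequentially"
proof (induction i)
  case 0
  show ?case by (simp add: gamma_ratio_same uniform_limit_const)
next
  case (Suc i)
  have bd: "bounded ((\<lambda>z. rGamma (- z) :: complex) ` K)"
    by (intro compact_imp_bounded compact_continuous_image K continuous_intros continuous_on_rGamma_compose)
  have "uniform_limit K (\<lambda>n z. of_nat (Suc (n - Suc i)) / (of_nat (n - Suc i) - z)) (\<lambda>_. 1 :: complex) sequentially"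
    using filterlim_compose[OF uniform_limit_shift_quotient[OF compact_imp_bounded[OF K]] filterlim_minus_const_nat] .
  from uniform_lim_mult[OF Suc this bd]
  have lim: "uniform_limit K (\<lambda>n z. gamma_ratio n (n - i) z * (of_nat (Suc (n - Suc i)) / (of_nat (n - Suc i) - z)))
      (\<lambda>z. rGamma (- z)) sequentially"
    by (simp add: bounded_iff) blast
  obtain R where R: "\<And>z. z \<in> K \<Longrightarrow> norm z \<le> R"
    using compact_imp_bounded[OF K] by (auto simp: bounded_iff)
  show ?case
  proof (rule uniform_limit_cong[THEN iffD1, OF _ _ lim])
    show "\<forall>\<^sub>F n in sequentially. \<forall>z\<in>K.
        gamma_ratio n (n - i) z * (of_nat (Suc (n - Suc i)) / (of_nat (n - Suc i) - z)) = gamma_ratio n (n - Suc i) z"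
      using eventually_gt_at_top[of i] eventually_of_nat_gt[of "R + real (Suc i)"]
    proof eventually_elim
      case (elim n)
      show ?case
      proof
        fix z assume z: "z \<in> K"
        have "norm (of_nat (n - Suc i) :: complex) > R"
          using elim by (simp only: norm_of_nat)
        hence "of_nat (n - Suc i) - z \<noteq> 0" using R[OF z] by auto
        moreover have "gamma_ratio n (n - Suc i) z * (of_nat (n - Suc i) - z) =
            gamma_ratio n (n - i) z * of_nat (Suc (n - Suc i))"
          using gamma_ratio_Suc_right[of n "n - Suc i" z] elim by (simp add: Suc_diff_Suc del: of_nat_Suc)
        ultimately show "gamma_ratio n (n - i) z * (of_nat (Suc (n - Suc i)) / (of_nat (n - Suc i) - z)) = gamma_ratio n (n - Suc i) z"
          by (simp add: field_simps)
      qed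
    qed
  qed auto
qed

text \<open>
The Cauchy product in the generating function.  The three signs, from \<open>(b - 1)\<^sup>n\<close> and from the
two factors, cancel.
\<close>
lemma theta_cm_value:
  fixes a b z :: complex
  assumes "b \<noteq> 1"
  shows "(b - 1) ^ n * rGamma (of_nat n - z) * cm_value a b n z =
    (\<Sum>i\<le>n. gamma_ratio n (n - i) z * (step_pochhammer b (a + b * z) i / fact i))"
proof -
  have 1: "step_pochhammer (-1) z m = (-1) ^ m * pochhammer (- z) m" for m
    using step_pochhammer_scale[of "-1" 1 "- z" m] by (simp add: step_pochhammer_1)
  have 2: "step_pochhammer (- b) (- (a + b * z)) m = (-1) ^ m * step_pochhammer b (a + b * z) m" for m
    using step_pochhammer_scale[of "-1" b "a + b * z" m] by simp
  have "(b - 1) ^ n = (-1) ^ n * (1 - b) ^ n"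
    by (simp add: power_mult_distrib[symmetric])
  hence "(b - 1) ^ n * rGamma (of_nat n - z) * cm_value a b n z =
     (-1) ^ n * (fact n * rGamma (of_nat n - z)) * cm_series a b z $ n"
    using assms by (simp add: cm_value_def)
  also have "cm_series a b z $ n =
      (\<Sum>i\<le>n. step_series (- b) (- (a + b * z)) $ i * step_series (-1) z $ (n - i))"
    unfolding cm_series_def by (subst mult.commute) (simp add: fps_mult_nth atLeast0AtMost)
  also have "(-1) ^ n * (fact n * rGamma (of_nat n - z)) * \<dots> =
     (\<Sum>i\<le>n. gamma_ratio n (n - i) z * (step_pochhammer b (a + b * z) i / fact i))"
    unfolding sum_distrib_left
  proof (rule sum.cong)
    fix i assume "i \<in> {..n}"
    hence "(-1::complex) ^ n = (-1) ^ i * (-1) ^ (n - i)" by (simp flip: power_add)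
    thus "(- 1) ^ n * (fact n * rGamma (of_nat n - z)) *
         (step_series (- b) (- (a + b * z)) $ i * step_series (- 1) z $ (n - i)) =
         gamma_ratio n (n - i) z * (step_pochhammer b (a + b * z) i / fact i)"
      unfolding step_series_nth 1 2 gamma_ratio_def by (simp add: mult_ac)
  qed simp
  finally show ?thesis .
qed

section \<open>Limits of backward differences\<close>

lemma step_pochhammer_affine_geometric_bound:
  fixes a b :: complex
  assumes K: "compact K" and b: "norm b < 1"
  shows "\<exists>C \<rho>. 0 < \<rho> \<and> \<rho> < 1 \<and>
    (\<forall>i. \<forall>z\<in>K. norm (step_pochhammer b (a + b * z) i / fact i) \<le> C * \<rho> ^ i)"
proof -
  obtain \<rho> where \<rho>: "norm b < \<rho>" "\<rho> < 1" using dense[OF b] by blast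
  have "\<rho> > 0" using \<rho>(1) norm_ge_zero[of b] by linarith
  obtain R where R: "\<And>z. z \<in> K \<Longrightarrow> norm z \<le> R"
    using compact_imp_bounded[OF K] by (auto simp: bounded_iff)
  have u: "norm (a + b * z) \<le> norm a + norm b * R" if "z \<in> K" for z
    using R[OF that] by (intro norm_triangle_le) (simp add: norm_mult mult_left_mono)
  obtain C where C: "\<forall>i. \<forall>v\<in>{v. norm v \<le> norm a + norm b * R}. norm (step_pochhammer b v i / fact i) \<le> C * \<rho> ^ i"
    using step_pochhammer_geometric_bound[OF \<rho>(1)] by blast
  have "norm (step_pochhammer b (a + b * z) i / fact i) \<le> C * \<rho> ^ i" if "z \<in> K" for i z
    using C u[OF that] by simp
  thus ?thesis using \<open>\<rho> > 0\<close> \<rho>(2) by blast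
qed

lemma uniform_limit_theta_cm_value:
  fixes a b :: complex
  assumes K: "compact K" and b: "norm b < 1"
  shows "uniform_limit K (\<lambda>n z. (b - 1) ^ n * rGamma (of_nat n - z) * cm_value a b n z)
    (\<lambda>z. rGamma (- z) * (\<Sum>i. step_pochhammer b (a + b * z) i / fact i)) sequentially"
proof -
  define h where "h = (\<lambda>i z. step_pochhammer b (a + b * z) i / fact i)"
  define f where "f = (\<lambda>n i z. if i \<le> n then gamma_ratio n (n - i) z * h i z else 0)"
  obtain C2 \<rho> where "\<rho> > 0" "\<rho> < 1" and
    "\<forall>i. \<forall>z\<in>K. norm (step_pochhammer b (a + b * z) i / fact i) \<le> C2 * \<rho> ^ i"
    using step_pochhammer_affine_geometric_bound[OF K b, of a] by blast
  hence C2: "norm (h i z) \<le> C2 * \<rho> ^ i" if "z \<in> K" for i z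
    using that by (simp add: h_def)
  obtain q where q: "1 < q" "q < 1 / \<rho>" using dense[of 1 "1 / \<rho>"] \<open>\<rho> > 0\<close> \<open>\<rho> < 1\<close> by auto
  \<comment> \<open>The growth of the Gamma ratios is chosen slower than the decay of the products.\<close>
  have "q * \<rho> < 1" using q(2) \<open>\<rho> > 0\<close> by (simp add: field_simps)
  obtain C1 where C1: "\<And>n m z. z \<in> K \<Longrightarrow> m \<le> n \<Longrightarrow> norm (gamma_ratio n m z) \<le> C1 * q ^ (n - m)"
    using gamma_ratio_bound[OF K q(1)] by blast
  have "uniform_limit K (\<lambda>n z. \<Sum>i. f n i z) (\<lambda>z. \<Sum>i. rGamma (- z) * h i z) sequentially"
  proof (rule uniform_limit_suminf_dominated)
    fix i
    have "uniform_limit K (\<lambda>n z. gamma_ratio n (n - i) z * h i z) (\<lambda>z. rGamma (- z) * h i z) sequentially"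
    proof (rule uniform_lim_mult[OF uniform_limit_gamma_ratio[OF K] uniform_limit_const])
      show "bounded ((\<lambda>z. rGamma (- z) :: complex) ` K)"
        by (intro compact_imp_bounded compact_continuous_image K continuous_intros continuous_on_rGamma_compose)
      show "bounded (h i ` K)" using C2 by (auto simp: bounded_iff)
    qed
    thus "uniform_limit K (\<lambda>n. f n i) (\<lambda>z. rGamma (- z) * h i z) sequentially"
    proof (rule uniform_limit_cong[THEN iffD1, rotated 2])
      show "\<forall>\<^sub>F n in sequentially. \<forall>z\<in>K. gamma_ratio n (n - i) z * h i z = f n i z"
        using eventually_ge_at_top[of i] by eventually_elim (simp add: f_def)
    qed auto
  next
    fix n i z assume z: "z \<in> K"
    have "0 \<le> C1" "0 \<le> C2"
      using order_trans[OF norm_ge_zero C1[OF z order_refl]] order_trans[OF norm_ge_zero C2[OF z, of 0]] by simp_all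
    have "norm (f n i z) \<le> (C1 * q ^ i) * (C2 * \<rho> ^ i)"
    proof (cases "i \<le> n")
      case True
      have "norm (gamma_ratio n (n - i) z * h i z) \<le> (C1 * q ^ i) * (C2 * \<rho> ^ i)"
        unfolding norm_mult using C1[OF z, of "n - i" n] True
        by (intro mult_mono C2 z) (use \<open>0 \<le> C1\<close> q in auto)
      thus ?thesis using True by (simp add: f_def)
    next
      case False
      thus ?thesis using \<open>0 \<le> C1\<close> \<open>0 \<le> C2\<close> q \<open>\<rho> > 0\<close> by (simp add: f_def)
    qed
    thus "norm (f n i z) \<le> C1 * C2 * (q * \<rho>) ^ i" by (simp add: power_mult_distrib mult_ac)
  next
    show "summable (\<lambda>i. C1 * C2 * (q * \<rho>) ^ i)"
      using \<open>q * \<rho> < 1\<close> q \<open>\<rho> > 0\<close> by (intro summable_mult summable_geometric) simp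
  qed
  moreover have "(\<Sum>i. f n i z) = (b - 1) ^ n * rGamma (of_nat n - z) * cm_value a b n z" for n z
  proof -
    have "(\<Sum>i. f n i z) = (\<Sum>i\<le>n. f n i z)" by (intro suminf_finite) (auto simp: f_def)
    also have "\<dots> = (\<Sum>i\<le>n. gamma_ratio n (n - i) z * h i z)" by (intro sum.cong) (auto simp: f_def)
    also have "\<dots> = (b - 1) ^ n * rGamma (of_nat n - z) * cm_value a b n z"
      using b by (subst theta_cm_value) (auto simp: h_def)
    finally show ?thesis .
  qed
  moreover have "(\<Sum>i. rGamma (- z) * h i z) = rGamma (- z) * (\<Sum>i. h i z)" if "z \<in> K" for z
  proof (rule suminf_mult)
    show "summable (\<lambda>i. h i z)"
    proof (rule summable_comparison_test')
      show "summable (\<lambda>i. C2 * \<rho> ^ i)"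
        using \<open>\<rho> > 0\<close> \<open>\<rho> < 1\<close> by (intro summable_mult summable_geometric) simp
    qed (rule C2[OF that])
  qed
  ultimately show ?thesis
    unfolding h_def by (subst uniform_limit_cong'[OF refl]) auto
qed

lemma falling_factorial_Suc: "falling_factorial x (Suc k) = falling_factorial x k * (x - of_nat k)"
  by (simp add: falling_factorial_def)

lemma falling_factorial_nonzero: "k \<le> n \<Longrightarrow> falling_factorial (of_nat n) k \<noteq> 0"
  by (auto simp: falling_factorial_def)

text \<open>
Each application of the lowering relation raises \<open>a\<close> by \<open>b\<close> and lowers the degree and the
argument by one.
\<close>
lemma nabla_power_cm_value:
  assumes "b \<noteq> 1" "k \<le> n"
  shows "(nabla ^^ k) (cm_value a b n) =
    (\<lambda>z. falling_factorial (of_nat n) k * cm_value (a + of_nat k * b) b (n - k) (z - of_nat k))"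
  using assms(2)
proof (induction k)
  case (Suc k)
  obtain m where m: "n - k = Suc m" using Suc.prems by (metis Suc_diff_Suc Suc_le_lessD)
  have "of_nat n - of_nat k = (of_nat (Suc m) :: complex)"
    using m Suc.prems by (metis Suc_leD of_nat_diff)
  hence ff: "falling_factorial (of_nat n) (Suc k) = falling_factorial (of_nat n) k * of_nat (Suc m)"
    by (simp only: falling_factorial_Suc)
  have "n - Suc k = m" using m by simp
  have "(nabla ^^ Suc k) (cm_value a b n) z = falling_factorial (of_nat n) (Suc k)
      * cm_value (a + of_nat (Suc k) * b) b (n - Suc k) (z - of_nat (Suc k))" for z
  proof -
    have "(nabla ^^ Suc k) (cm_value a b n) z = nabla ((nabla ^^ k) (cm_value a b n)) z" by simp
    also have "\<dots> = falling_factorial (of_nat n) k *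
       (cm_value (a + of_nat k * b) b (Suc m) (z - of_nat (Suc k) + 1)
        - cm_value (a + of_nat k * b) b (Suc m) (z - of_nat (Suc k)))"
    proof -
      have "z - of_nat (Suc k) + 1 = z - of_nat k" "z - of_nat (Suc k) = z - 1 - of_nat k" by simp_all
      moreover have "(nabla ^^ k) (cm_value a b n) = (\<lambda>z. falling_factorial (of_nat n) k *
          cm_value (a + of_nat k * b) b (Suc m) (z - of_nat k))"
        using Suc m by simp
      ultimately show ?thesis by (simp only: nabla_def right_diff_distrib)
    qed
    also have "\<dots> = falling_factorial (of_nat n) (Suc k) * cm_value (a + of_nat k * b + b) b m (z - of_nat (Suc k))"
      unfolding cm_value_difference[OF assms(1)] ff by (simp only: mult.assoc)
    finally show ?thesis unfolding \<open>n - Suc k = m\<close> by (simp add: algebra_simps)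
  qed
  thus ?case by blast
qed (simp add: falling_factorial_def)

text \<open>
The reduction to \<open>k = 0\<close>: shifting \<open>n\<close> and \<open>z\<close> by \<open>k\<close> leaves \<open>1 / \<Gamma>(n - z)\<close> unchanged,
and replacing \<open>a\<close> by \<open>a + k b\<close> at the same time leaves \<open>a + b z\<close> unchanged.  Only
\<open>(b - 1)\<^sup>k\<close> is left over.
\<close>
lemma uniform_limit_theta_nabla_cm_value:
  fixes a b :: complex
  assumes K: "compact K" and b: "norm b < 1"
  shows "uniform_limit K (\<lambda>n z. (b - 1) ^ n * rGamma (of_nat n - z) / falling_factorial (of_nat n) k
      * (nabla ^^ k) (cm_value a b n) z)
    (\<lambda>z. (b - 1) ^ k * (rGamma (of_nat k - z) * (\<Sum>i. step_pochhammer b (a + b * z) i / fact i))) sequentially"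
proof -
  define a' where "a' = a + of_nat k * b"
  define F where "F = (\<lambda>n z. (b - 1) ^ n * rGamma (of_nat n - z) * cm_value a' b n z)"
  define G where "G = (\<lambda>z. rGamma (- z) * (\<Sum>i. step_pochhammer b (a' + b * z) i / fact i))"
  have b1: "b \<noteq> 1" using b by auto
  have "compact ((\<lambda>z. z - of_nat k) ` K)"
    by (intro compact_continuous_image K continuous_intros)
  hence "uniform_limit ((\<lambda>z. z - of_nat k) ` K) F G sequentially"
    unfolding F_def G_def by (rule uniform_limit_theta_cm_value[OF _ b])
  hence "uniform_limit K (\<lambda>n z. F n (z - of_nat k)) (\<lambda>z. G (z - of_nat k)) sequentially"
    by (rule uniform_limit_compose') auto
  from filterlim_compose[OF this filterlim_minus_const_nat[of k]]
  have "uniform_limit K (\<lambda>n z. F (n - k) (z - of_nat k)) (\<lambda>z. G (z - of_nat k)) sequentially" .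
  hence lim: "uniform_limit K (\<lambda>n z. (b - 1) ^ k * F (n - k) (z - of_nat k)) (\<lambda>z. (b - 1) ^ k * G (z - of_nat k)) sequentially"
    by (rule bounded_linear_uniform_limit_intros)
  have G: "G (z - of_nat k) = rGamma (of_nat k - z) * (\<Sum>i. step_pochhammer b (a + b * z) i / fact i)" for z
    by (simp add: G_def a'_def algebra_simps)
  show ?thesis unfolding G[symmetric]
  proof (rule uniform_limit_cong[THEN iffD1, OF _ _ lim])
    show "\<forall>\<^sub>F n in sequentially. \<forall>z\<in>K. (b - 1) ^ k * F (n - k) (z - of_nat k) =
       (b - 1) ^ n * rGamma (of_nat n - z) / falling_factorial (of_nat n) k * (nabla ^^ k) (cm_value a b n) z"
      using eventually_ge_at_top[of k]
    proof eventually_elim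
      case (elim n)
      have "(b - 1) ^ n = (b - 1) ^ k * (b - 1) ^ (n - k)" using elim by (simp flip: power_add)
      moreover have "rGamma (of_nat (n - k) - (z - of_nat k)) = rGamma (of_nat n - z)" for z :: complex
        using elim by (simp add: of_nat_diff)
      ultimately show ?case
        using falling_factorial_nonzero[OF elim]
        by (simp add: F_def a'_def nabla_power_cm_value[OF b1 elim])
    qed
  qed auto
qed

lemma nabla_power_diff_smult:
  "(nabla ^^ k) (\<lambda>z. f z - c * nabla f z) z = (nabla ^^ k) f z - c * (nabla ^^ Suc k) f z"
proof (induction k arbitrary: z)
  case (Suc k)
  have "(nabla ^^ Suc k) (\<lambda>z. f z - c * nabla f z) z =
     nabla ((nabla ^^ k) (\<lambda>z. f z - c * nabla f z)) z"
    by simp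
  also have "\<dots> = nabla ((nabla ^^ k) f) z - c * nabla ((nabla ^^ Suc k) f) z"
    unfolding nabla_def[of "(nabla ^^ k) (\<lambda>z. f z - c * nabla f z)"] Suc
      nabla_def[of "(nabla ^^ k) f"] nabla_def[of "(nabla ^^ Suc k) f"]
    by (simp only: algebra_simps)
  also have "\<dots> = (nabla ^^ Suc k) f z - c * (nabla ^^ Suc (Suc k)) f z"
    by simp
  finally show ?case .
qed simp

text \<open>
The correction contains one backward difference more than the normalisation by \<open>[n]\<^sub>k\<close> accounts
for, which costs a factor \<open>n - k\<close>; this is why \<open>c n\<close> has to be \<open>o(1 / n)\<close>.
\<close>
lemma uniform_limit_theta_nabla_perturbed:
  fixes a b :: complex and c :: "nat \<Rightarrow> complex"
  assumes K: "compact K" and b: "norm b < 1"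
    and c: "(\<lambda>n. c n * of_nat n) \<longlonglongrightarrow> 0"
    and g: "\<And>n. n > 0 \<Longrightarrow> g n = (\<lambda>z. cm_value a b n z - c n * nabla (cm_value a b n) z)"
  shows "uniform_limit K (\<lambda>n z. (b - 1) ^ n * rGamma (of_nat n - z) / falling_factorial (of_nat n) k
      * (nabla ^^ k) (g n) z)
    (\<lambda>z. (b - 1) ^ k * (rGamma (of_nat k - z) * (\<Sum>i. step_pochhammer b (a + b * z) i / fact i))) sequentially"
proof -
  define T where "T = (\<lambda>k n z. (b - 1) ^ n * rGamma (of_nat n - z) / falling_factorial (of_nat n) k
      * (nabla ^^ k) (cm_value a b n) z)"
  define L where "L = (\<lambda>k z. (b - 1) ^ k * (rGamma (of_nat k - z) * (\<Sum>i. step_pochhammer b (a + b * z) i / fact i)))"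
  have T: "uniform_limit K (T k) (L k) sequentially" for k
    unfolding T_def L_def by (rule uniform_limit_theta_nabla_cm_value[OF K b])
  have bounded_L: "bounded (L k ` K)" for k
  proof -
    obtain C \<rho> where "0 < \<rho>" "\<rho> < 1"
      and C: "\<forall>i. \<forall>z\<in>K. norm (step_pochhammer b (a + b * z) i / fact i) \<le> C * \<rho> ^ i"
      using step_pochhammer_affine_geometric_bound[OF K b, of a] by blast
    have sm: "summable (\<lambda>i. C * \<rho> ^ i)"
      using \<open>0 < \<rho>\<close> \<open>\<rho> < 1\<close> by (intro summable_mult summable_geometric) auto
    have "continuous_on K (\<lambda>z. rGamma (of_nat k - z) :: complex)"
      by (intro continuous_intros continuous_on_rGamma_compose)
    then obtain B where B: "\<And>z. z \<in> K \<Longrightarrow> norm (rGamma (of_nat k - z)) \<le> B"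
      using compact_continuous_bound[OF K] by blast
    have "norm (L k z) \<le> norm (b - 1) ^ k * (B * (\<Sum>i. C * \<rho> ^ i))" if z: "z \<in> K" for z
      unfolding L_def norm_mult norm_power
      by (intro mult_left_mono mult_mono B z norm_suminf_le C[rule_format] sm order_trans[OF norm_ge_zero B[OF z]])
         auto
    thus ?thesis by (auto simp: bounded_iff)
  qed
  define e where "e = (\<lambda>n. c n * of_nat (n - k))"
  have "e \<longlonglongrightarrow> 0"
  proof (rule Lim_null_comparison[OF _ tendsto_norm_zero[OF c]])
    show "\<forall>\<^sub>F n in sequentially. norm (e n) \<le> norm (c n * of_nat n)"
      by (intro always_eventually) (auto simp: e_def norm_mult intro!: mult_left_mono)
  qed
  hence e: "uniform_limit K (\<lambda>n _. e n) (\<lambda>_. 0) sequentially"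
    by (auto intro!: uniform_limitI dest: tendstoD)
  have "uniform_limit K (\<lambda>n z. e n * T (Suc k) n z) (\<lambda>z. 0 * L (Suc k) z) sequentially"
    by (rule uniform_lim_mult[OF e T _ bounded_L]) (auto simp: bounded_iff)
  from uniform_limit_minus[OF T[of k] this]
  have lim: "uniform_limit K (\<lambda>n z. T k n z - e n * T (Suc k) n z) (L k) sequentially" by simp
  have "uniform_limit K (\<lambda>n z. (b - 1) ^ n * rGamma (of_nat n - z) / falling_factorial (of_nat n) k
      * (nabla ^^ k) (g n) z) (L k) sequentially"
  proof (rule uniform_limit_cong[THEN iffD1, OF _ _ lim])
    show "\<forall>\<^sub>F n in sequentially. \<forall>z\<in>K. T k n z - e n * T (Suc k) n z =
      (b - 1) ^ n * rGamma (of_nat n - z) / falling_factorial (of_nat n) k * (nabla ^^ k) (g n) z"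
      using eventually_gt_at_top[of k]
    proof eventually_elim
      case (elim n)
      have "of_nat n - of_nat k = (of_nat (n - k) :: complex)" using elim by (simp add: of_nat_diff)
      hence ff: "falling_factorial (of_nat n) (Suc k) = falling_factorial (of_nat n) k * of_nat (n - k)"
        by (simp only: falling_factorial_Suc)
      have "e n * T (Suc k) n z = (b - 1) ^ n * rGamma (of_nat n - z) / falling_factorial (of_nat n) k
          * (c n * (nabla ^^ Suc k) (cm_value a b n) z)" for z
      proof -
        define N where "N = complex_of_nat (n - k)"
        have "N \<noteq> 0" using elim by (simp add: N_def del: of_nat_diff)
        thus ?thesis unfolding e_def T_def ff N_def[symmetric] by simp
      qed
      moreover have "(nabla ^^ k) (g n) z =
          (nabla ^^ k) (cm_value a b n) z - c n * (nabla ^^ Suc k) (cm_value a b n) z" for z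
        using elim g[of n] by (simp only: nabla_power_diff_smult)
      ultimately show ?case by (simp only: T_def right_diff_distrib) simp
    qed
  qed auto
  thus ?thesis by (simp only: L_def)
qed

section \<open>Specialisation to Charlier and Meixner\<close>

lemma cpoly_shift: "cpoly (p \<circ>\<^sub>p [:-1, 1:]) z = cpoly p (z - 1)"
  by (induction p) (simp_all add: pcompose_pCons cpoly_const cpoly_pCons cpoly_add cpoly_mult algebra_simps del: mult_pCons_left)

lemma cpoly_cm_kernel:
  assumes "b \<noteq> 1"
  shows "cpoly (cm_kernel a b n) z = nabla (cm_value (of_real a) (of_real b) (Suc n)) z"
proof -
  have "nabla (cm_value (of_real a) (of_real b) (Suc n)) z =
      of_nat (Suc n) * cm_value (of_real a + of_real b) (of_real b) n (z - 1)"
    using cm_value_difference[of "complex_of_real b" "of_real a" n "z - 1"] assms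
    by (simp add: nabla_def del: of_nat_Suc)
  thus ?thesis
    using cpoly_cm_poly[OF assms, of "a + b" n "z - 1"]
    by (simp add: cm_kernel_def cpoly_smult cpoly_shift del: of_nat_Suc)
qed

lemma uniform_limit_theta_nabla_mass_modified:
  fixes a b B :: real
  assumes a: "a > 0" and b: "0 \<le> b" "b < 1" and B: "B \<ge> 0"
    and C: "\<And>n. degree (C n) = n" "\<And>n. coeff (C n) n = 1"
    and orth: "\<And>m n. m \<noteq> n \<Longrightarrow> cm_functional a b (C m * C n) + B * poly (C m) 0 * poly (C n) 0 = 0"
    and K: "compact K"
  shows "uniform_limit K (\<lambda>n z. (complex_of_real b - 1) ^ n * rGamma (of_nat n - z) / falling_factorial (of_nat n) k
      * (nabla ^^ k) (cpoly (C n)) z)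
    (\<lambda>z. (complex_of_real b - 1) ^ k * (rGamma (of_nat k - z) *
      (\<Sum>i. step_pochhammer (complex_of_real b) (of_real a + of_real b * z) i / fact i))) sequentially"
proof -
  have "\<exists>c. C (Suc n) = cm_poly a b (Suc n) - smult c (cm_kernel a b n) \<and>
     \<bar>c\<bar> * ((1 - b) * cm_functional a b 1) \<le> B * cm_weight a b (Suc n)" for n
  proof (rule mass_modified_eq[OF b a B C])
    fix q :: "real poly" assume "degree q \<le> n"
    thus "cm_functional a b (C (Suc n) * q) + B * poly (C (Suc n)) 0 * poly q 0 = 0"
      by (intro orthogonal_to_lower_degree[OF b C orth]) auto
  qed
  then obtain c where c: "\<And>n. C (Suc n) = cm_poly a b (Suc n) - smult (c n) (cm_kernel a b n)"
    and c_bound: "\<And>n. \<bar>c n\<bar> * ((1 - b) * cm_functional a b 1) \<le> B * cm_weight a b (Suc n)"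
    by metis
  \<comment> \<open>The correction at degree \<open>n\<close> is \<open>O(w a b n)\<close>, hence decays geometrically.\<close>
  define D where "D = (1 - b) * cm_functional a b 1"
  have "D > 0" using cm_functional_square_pos[OF b a, of 1] b by (simp add: D_def)
  obtain W \<rho> where \<rho>: "b < \<rho>" "\<rho> < 1" and W: "\<And>x. \<bar>cm_weight a b x\<bar> \<le> W * \<rho> ^ x"
    using cm_weight_geometric_bound[OF b] by metis
  \<comment> \<open>\<open>c m\<close> belongs to degree \<open>m + 1\<close>.\<close>
  define c' where "c' = (\<lambda>n. complex_of_real (c (n - 1)))"
  have "(\<lambda>n. c' n * of_nat n) \<longlonglongrightarrow> 0"
  proof (rule Lim_null_comparison)
    have "(\<lambda>n. real n * \<rho> ^ n) \<longlonglongrightarrow> 0"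
      using \<rho> b by (intro powser_times_n_limit_0) auto
    hence "(\<lambda>n. B * W / D * (real n * \<rho> ^ n)) \<longlonglongrightarrow> B * W / D * 0"
      by (rule tendsto_mult_left)
    thus "(\<lambda>n. B * W / D * (real n * \<rho> ^ n)) \<longlonglongrightarrow> 0" by simp
    show "\<forall>\<^sub>F n in sequentially. norm (c' n * of_nat n) \<le> B * W / D * (real n * \<rho> ^ n)"
      using eventually_gt_at_top[of 0]
    proof eventually_elim
      case (elim n)
      then obtain m where m: "n = Suc m" by (cases n) auto
      have "\<bar>c m\<bar> * D \<le> B * (W * \<rho> ^ n)"
        using c_bound[of m] mult_left_mono[OF abs_le_D1[OF W[of n]] B] by (simp add: D_def m)
      hence "\<bar>c m\<bar> \<le> B * W / D * \<rho> ^ n" using \<open>D > 0\<close> by (simp add: field_simps)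
      hence "\<bar>c m\<bar> * real n \<le> B * W / D * \<rho> ^ n * real n" by (rule mult_right_mono) simp
      thus ?case by (simp add: c'_def m norm_mult mult_ac del: of_nat_Suc)
    qed
  qed
  moreover have "cpoly (C n) = (\<lambda>z. cm_value (of_real a) (of_real b) n z
      - c' n * nabla (cm_value (of_real a) (of_real b) n) z)" if "n > 0" for n
  proof -
    obtain m where m: "n = Suc m" using \<open>n > 0\<close> by (cases n) auto
    show ?thesis
      using b by (simp add: fun_eq_iff m c c'_def cpoly_diff cpoly_smult cpoly_cm_poly cpoly_cm_kernel)
  qed
  ultimately show ?thesis
    using b by (intro uniform_limit_theta_nabla_perturbed[OF K]) auto
qed

lemma charlier_weight: "cm_weight \<mu> 0 x = \<mu> ^ x / fact x"
  by (simp add: cm_weight_def step_pochhammer_def)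

lemma charlier_inner_eq: "charlier_inner \<mu> p q = exp (- \<mu>) * cm_functional \<mu> 0 (p * q)"
proof -
  have "cm_functional \<mu> 0 (p * q) * exp (- \<mu>) =
      (\<Sum>x. poly (p * q) (real x) * cm_weight \<mu> 0 x * exp (- \<mu>))"
    unfolding cm_functional_def by (rule suminf_mult2) (simp add: summable_poly_cm_weight del: poly_mult)
  thus ?thesis unfolding charlier_inner_def by (simp add: charlier_weight mult_ac)
qed

lemma meixner_inner_eq: "meixner_inner \<gamma> \<mu> p q = cm_functional (\<mu> * \<gamma>) \<mu> (p * q)"
  using step_pochhammer_scale[of \<mu> 1 \<gamma>]
  by (simp add: meixner_inner_def cm_functional_def cm_weight_def step_pochhammer_1 mult_ac)

text \<open>
In both cases the limit of the sum over \<open>i\<close> is an elementary function: the exponential series here,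
the binomial series with exponent \<open>- (\<gamma> + z)\<close> below.
\<close>
lemma charlier_mass_series: "(\<Sum>i. step_pochhammer 0 v i / fact i) = exp (v :: complex)"
  by (simp add: exp_def step_pochhammer_def scaleR_conv_of_real divide_inverse mult.commute)

lemma meixner_mass_series:
  assumes "0 < \<mu>" "\<mu> < 1"
  shows "(\<Sum>i. step_pochhammer (of_real \<mu>) (of_real (\<mu> * \<gamma>) + of_real \<mu> * z) i / fact i) =
    1 / cpow (1 - \<mu>) (of_real \<gamma> + z)"
proof -
  have term_eq: "step_pochhammer (of_real \<mu>) (of_real (\<mu> * \<gamma>) + of_real \<mu> * z) i / fact i =
      (- (of_real \<gamma> + z) gchoose i) * (- of_real \<mu>) ^ i" for i
  proof -
    define w where "w = of_real \<gamma> + z"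
    have "step_pochhammer (of_real \<mu>) (of_real \<mu> * w) i = of_real \<mu> ^ i * pochhammer w i"
      using step_pochhammer_scale[of "complex_of_real \<mu>" 1 w i] by (simp add: step_pochhammer_1)
    moreover have "(- 1 :: complex) ^ i * (- of_real \<mu>) ^ i = of_real \<mu> ^ i"
      by (simp flip: power_mult_distrib)
    moreover have "(- w gchoose i) * (- of_real \<mu>) ^ i =
        ((- 1) ^ i * (- of_real \<mu>) ^ i) * (pochhammer w i / fact i)"
      by (simp add: gbinomial_pochhammer)
    moreover have "of_real (\<mu> * \<gamma>) + of_real \<mu> * z = of_real \<mu> * w"
      by (simp add: w_def algebra_simps)
    ultimately show ?thesis by (simp only: w_def times_divide_eq_right)
  qed
  have "(\<lambda>i. (- (of_real \<gamma> + z) gchoose i) * (- of_real \<mu>) ^ i) sums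
     (1 + - complex_of_real \<mu>) powr (- (of_real \<gamma> + z))"
    using assms by (intro gen_binomial_complex) auto
  hence "(\<Sum>i. step_pochhammer (of_real \<mu>) (of_real (\<mu> * \<gamma>) + of_real \<mu> * z) i / fact i) =
      complex_of_real (1 - \<mu>) powr (- (of_real \<gamma> + z))"
    unfolding term_eq by (simp add: sums_iff)
  also have "\<dots> = exp (- (of_real \<gamma> + z) * of_real (ln (1 - \<mu>)))"
    using assms by (simp add: powr_def Ln_of_real del: of_real_diff)
  also have "\<dots> = 1 / cpow (1 - \<mu>) (of_real \<gamma> + z)"
    unfolding cpow_def mult_minus_left exp_minus by (simp add: divide_inverse)
  finally show ?thesis .
qed

lemma charlier_limit_eq:
  "(complex_of_real 0 - 1) ^ k * (rGamma (of_nat k - z) *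
      (\<Sum>i. step_pochhammer (complex_of_real 0) (of_real \<mu> + of_real 0 * z) i / fact i)) =
    (- 1) ^ k * charlier_phi \<mu> (z - of_nat k)"
  by (simp add: charlier_phi_def charlier_mass_series exp_of_real mult_ac)

lemma meixner_limit_eq:
  assumes "0 < \<mu>" "\<mu> < 1"
  shows "(complex_of_real \<mu> - 1) ^ k * (rGamma (of_nat k - z) *
      (\<Sum>i. step_pochhammer (complex_of_real \<mu>) (of_real (\<mu> * \<gamma>) + of_real \<mu> * z) i / fact i)) =
    (- 1) ^ k * meixner_phi \<gamma> \<mu> (z - of_nat k)"
proof -
  have "exp (complex_of_real (ln (1 - \<mu>))) = of_real (1 - \<mu>)"
    using assms by (simp add: exp_of_real del: of_real_diff)
  hence "exp (of_nat k * complex_of_real (ln (1 - \<mu>))) = of_real (1 - \<mu>) ^ k"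
    by (simp only: exp_of_nat_mult)
  hence "cpow (1 - \<mu>) (of_real \<gamma> + (z - of_nat k)) = cpow (1 - \<mu>) (of_real \<gamma> + z) / of_real (1 - \<mu>) ^ k"
    by (simp add: cpow_def distrib_right left_diff_distrib exp_add exp_diff)
  moreover have "(complex_of_real \<mu> - 1) ^ k = (- 1) ^ k * of_real (1 - \<mu>) ^ k"
    by (simp flip: power_mult_distrib)
  moreover have "cpow (1 - \<mu>) (of_real \<gamma> + z) \<noteq> 0" by (simp add: cpow_def)
  ultimately show ?thesis
    unfolding meixner_mass_series[OF assms] by (simp add: meixner_phi_def)
qed

theorem theorem4p2:
  fixes k :: nat and A :: real
  assumes "A \<ge> 0"
  shows
    "(\<forall>\<mu>::real. \<mu> > 0 \<longrightarrow>
        (\<forall>C. monic_orthogonal (mass_inner (charlier_inner \<mu>) A) C \<longrightarrow>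
          locally_uniform_limit
            (\<lambda>n z. charlier_theta n z / falling_factorial (of_nat n) k
                     * (nabla ^^ k) (cpoly (C n)) z)
            (\<lambda>z. (- 1) ^ k * charlier_phi \<mu> (z - of_nat k))) \<and>
        locally_uniform_limit
          (\<lambda>n z. charlier_theta n z / falling_factorial (of_nat n) k
                   * (nabla ^^ k) (cpoly (charlier \<mu> n)) z)
          (\<lambda>z. (- 1) ^ k * charlier_phi \<mu> (z - of_nat k)) \<and>
        (\<forall>z. (- 1) ^ k * charlier_phi \<mu> (z - of_nat k)
               = (- 1) ^ k * (of_real (exp \<mu>) * rGamma (of_nat k - z))))
     \<and>
     (\<forall>\<gamma> \<mu>::real. \<gamma> > 0 \<longrightarrow> 0 < \<mu> \<longrightarrow> \<mu> < 1 \<longrightarrow>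
        (\<forall>M. monic_orthogonal (mass_inner (meixner_inner \<gamma> \<mu>) A) M \<longrightarrow>
          locally_uniform_limit
            (\<lambda>n z. meixner_theta \<mu> n z / falling_factorial (of_nat n) k
                     * (nabla ^^ k) (cpoly (M n)) z)
            (\<lambda>z. (- 1) ^ k * meixner_phi \<gamma> \<mu> (z - of_nat k))) \<and>
        locally_uniform_limit
          (\<lambda>n z. meixner_theta \<mu> n z / falling_factorial (of_nat n) k
                   * (nabla ^^ k) (cpoly (meixner \<gamma> \<mu> n)) z)
          (\<lambda>z. (- 1) ^ k * meixner_phi \<gamma> \<mu> (z - of_nat k)) \<and>
        (\<forall>z. (- 1) ^ k * meixner_phi \<gamma> \<mu> (z - of_nat k)
               = (- 1) ^ k * (1 / cpow (1 - \<mu>) (of_real \<gamma> + z - of_nat k)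
                                * rGamma (of_nat k - z))))"
proof (intro conjI allI impI)
  fix \<mu> :: real and C assume \<mu>: "\<mu> > 0" and "monic_orthogonal (mass_inner (charlier_inner \<mu>) A) C"
  hence C: "\<And>n. degree (C n) = n" "\<And>n. coeff (C n) n = 1"
    and orth: "\<And>m n. m \<noteq> n \<Longrightarrow> exp (- \<mu>) * cm_functional \<mu> 0 (C m * C n) + A * poly (C m) 0 * poly (C n) 0 = 0"
    unfolding monic_orthogonal_def mass_inner_def charlier_inner_eq by (metis, metis, metis)
  \<comment> \<open>Dividing by the normalisation \<open>exp (- \<mu>)\<close> of the weight changes the mass to \<open>A * exp \<mu>\<close>.\<close>
  have orth': "cm_functional \<mu> 0 (C m * C n) + (A * exp \<mu>) * poly (C m) 0 * poly (C n) 0 = 0"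
    if "m \<noteq> n" for m n
  proof -
    have "exp \<mu> * exp (- \<mu>) = 1" by (simp add: exp_minus)
    hence "cm_functional \<mu> 0 (C m * C n) + (A * exp \<mu>) * poly (C m) 0 * poly (C n) 0 =
        exp \<mu> * (exp (- \<mu>) * cm_functional \<mu> 0 (C m * C n) + A * poly (C m) 0 * poly (C n) 0)"
      by (simp only: distrib_left mult.assoc[symmetric]) (simp add: mult_ac)
    thus ?thesis using orth[OF that] by simp
  qed
  show "locally_uniform_limit
          (\<lambda>n z. charlier_theta n z / falling_factorial (of_nat n) k * (nabla ^^ k) (cpoly (C n)) z)
          (\<lambda>z. (- 1) ^ k * charlier_phi \<mu> (z - of_nat k))"
    unfolding locally_uniform_limit_def
    using uniform_limit_theta_nabla_mass_modified[where k = k, OF \<mu> _ _ _ C orth'] assms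
    unfolding charlier_limit_eq by (simp add: charlier_theta_def)
next
  fix \<mu> :: real assume \<mu>: "\<mu> > 0"
  have "cpoly (charlier \<mu> n) = cm_value (of_real \<mu>) (of_real 0) n" for n
    by (simp add: fun_eq_iff charlier_eq_cm_poly cpoly_cm_poly)
  thus "locally_uniform_limit
          (\<lambda>n z. charlier_theta n z / falling_factorial (of_nat n) k * (nabla ^^ k) (cpoly (charlier \<mu> n)) z)
          (\<lambda>z. (- 1) ^ k * charlier_phi \<mu> (z - of_nat k))"
    unfolding locally_uniform_limit_def
    using uniform_limit_theta_nabla_cm_value[where a = "of_real \<mu>" and b = "of_real 0" and k = k]
    unfolding charlier_limit_eq by (simp add: charlier_theta_def)
next
  fix \<gamma> \<mu> :: real and M assume \<mu>: "\<gamma> > 0" "0 < \<mu>" "\<mu> < 1"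
    and "monic_orthogonal (mass_inner (meixner_inner \<gamma> \<mu>) A) M"
  hence M: "\<And>n. degree (M n) = n" "\<And>n. coeff (M n) n = 1"
    and orth: "\<And>m n. m \<noteq> n \<Longrightarrow> cm_functional (\<mu> * \<gamma>) \<mu> (M m * M n) + A * poly (M m) 0 * poly (M n) 0 = 0"
    unfolding monic_orthogonal_def mass_inner_def meixner_inner_eq by (metis, metis, metis)
  have "\<mu> * \<gamma> > 0" using \<mu> by simp
  from uniform_limit_theta_nabla_mass_modified[where k = k, OF this _ _ assms M orth] \<mu>
  show "locally_uniform_limit
          (\<lambda>n z. meixner_theta \<mu> n z / falling_factorial (of_nat n) k * (nabla ^^ k) (cpoly (M n)) z)
          (\<lambda>z. (- 1) ^ k * meixner_phi \<gamma> \<mu> (z - of_nat k))"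
    unfolding locally_uniform_limit_def meixner_limit_eq[OF \<mu>(2,3)]
    by (simp add: meixner_theta_def)
next
  fix \<gamma> \<mu> :: real assume \<mu>: "\<gamma> > 0" "0 < \<mu>" "\<mu> < 1"
  have "cpoly (meixner \<gamma> \<mu> n) = cm_value (of_real (\<mu> * \<gamma>)) (of_real \<mu>) n" for n
    using \<mu> by (simp add: fun_eq_iff meixner_eq_cm_poly cpoly_cm_poly)
  thus "locally_uniform_limit
          (\<lambda>n z. meixner_theta \<mu> n z / falling_factorial (of_nat n) k * (nabla ^^ k) (cpoly (meixner \<gamma> \<mu> n)) z)
          (\<lambda>z. (- 1) ^ k * meixner_phi \<gamma> \<mu> (z - of_nat k))"
    unfolding locally_uniform_limit_def
    using uniform_limit_theta_nabla_cm_value[where a = "of_real (\<mu> * \<gamma>)" and b = "of_real \<mu>" and k = k] \<mu>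
    unfolding meixner_limit_eq[OF \<mu>(2,3)] by (simp add: meixner_theta_def)
qed (simp_all add: charlier_phi_def meixner_phi_def add_diff_eq)

end
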